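(* Let $T>0$ and let $Y(t)=\sum_{i=1}^{N(t)}X_i\,h_i(t,T_i)$, $t\ge0$, be a shot noise process as described in the context, where $\{N(t)\}$ is an inhomogeneous Poisson process with intensity function $\lambda(\cdot)$, cumulative intensity function $m(\cdot)$ and points $T_1\le T_2\le\cdots$. Let $V_0$ be a random variable, independent of $h_0$, with density $\lambda(t)/m(T)$, $0\le t\le T$. Assume that, for some $\alpha>0$: (i) the nonnegative random variables $X_i$ are identically distributed with common (finite) mean $\gamma$, and $x\mapsto\overline F_X(x)=\mathbb{P}(X_1>x)$ is regularly varying at infinity with index $-\alpha$; (ii) $\displaystyle\sup_{i\neq j}\frac{\mathbb{P}(X_i>x,X_j>x)}{\mathbb{P}(X_1>x)}\to0$ as $x\to\infty$; (iii) the random functions $h_j(T,\cdot)$ are i.i.d., independent of the $T_j$'s, and integrable of order $p$ for some $p>\alpha$, i.e. $\mathbb{E}[h_0^{p}(T,V_0)]<\infty$. Then the expected severity $ES(x)=\mathbb{E}\big[[Y(T)-x]_+\big]$ satisfies $$ES(x)\underset{x\to\infty}{\sim}\gamma\,m(T)\,\mathbb{E}[h_0^{\alpha}(T,V_0)]\;\overline{F_X^{I}}(x).$$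
   Context: The shocks $(X_i)_{i\ge1}$ are nonnegative random variables (not necessarily independent of each other); the shock functions $(h_i)$ are i.i.d. nonnegative measurable random functions $(t,s)\mapsto h_i(t,s)$, $h_0$ denoting a generic copy; the shock instants $(T_i)_{i\ge1}$ are the points of the Poisson process and $N(t)=\#\{i:T_i\le t\}$. The sequence $(X_i)$ is independent of the $(h_i)$ and of the $(T_i)$. Here $m(t)=\int_0^t\lambda(s)\,ds=\mathbb{E}[N(t)]$, with $0<m(T)<\infty$. $[\cdot]_+$ is the positive part, $h_0^\alpha(t,s)$ means $(h_0(t,s))^\alpha$, and the integrated tail is $\overline{F_X^I}(y)=\frac1\gamma\int_y^\infty\overline F_X(x)\,dx$, $y>0$. For a constant $c\ge0$, $f(x)\sim c\,g(x)$ means $f(x)/g(x)\to c$ as $x\to\infty$. *)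

theory Defs
  imports "HOL-Probability.Probability"
begin

text \<open>
  Sequences are indexed by the natural numbers \<open>i \<ge> 1\<close>.

  Random functions are random elements of a function space equipped with a sigma-algebra
  for which the evaluation map is jointly measurable. The product sigma-algebra and joint
  measurability in \<open>(\<omega>, s)\<close> alone would not do: with \<open>V\<close> uniform on \<open>[0,1]\<close>, the function
  \<open>f \<omega> s = (if s = V \<omega> then 1 else 0)\<close> is jointly measurable and its finite-dimensional
  marginals are independent of \<open>V\<close>, although \<open>f \<omega> (V \<omega>) = 1\<close> always.
\<close>

text \<open>The library's \<open>indep_var\<close> requires both random elements to have values in the same type.\<close>

definition indep_elements ::
  "'w measure \<Rightarrow> 'a measure \<Rightarrow> ('w \<Rightarrow> 'a) \<Rightarrow> 'b measure \<Rightarrow> ('w \<Rightarrow> 'b) \<Rightarrow> bool" where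
  "indep_elements M A X B Y \<longleftrightarrow>
     X \<in> measurable M A \<and> Y \<in> measurable M B \<and>
     prob_space.indep_set M
       {X -` a \<inter> space M | a. a \<in> sets A} {Y -` b \<inter> space M | b. b \<in> sets B}"

definition iid :: "'w measure \<Rightarrow> 'a measure \<Rightarrow> (nat \<Rightarrow> 'w \<Rightarrow> 'a) \<Rightarrow> bool" where
  "iid M K Z \<longleftrightarrow>
     prob_space.indep_vars M (\<lambda>_. K) Z {1..} \<and> (\<forall>i\<ge>1. distr M K (Z i) = distr M K (Z 1))"

definition random_sequence :: "(nat \<Rightarrow> 'w \<Rightarrow> 'a) \<Rightarrow> 'w \<Rightarrow> nat \<Rightarrow> 'a" where
  "random_sequence Z \<omega> = (\<lambda>i\<in>{1..}. Z i \<omega>)"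

definition cumulative_intensity :: "(real \<Rightarrow> real) \<Rightarrow> real \<Rightarrow> real" where
  "cumulative_intensity lam t = (LBINT s:{0..t}. lam s)"

definition counting :: "(nat \<Rightarrow> 'w \<Rightarrow> ereal) \<Rightarrow> real \<Rightarrow> 'w \<Rightarrow> nat" where
  "counting \<tau> t \<omega> = card {i. 1 \<le> i \<and> \<tau> i \<omega> \<le> ereal t}"

text \<open>
  The points are extended reals: if the total mass of the intensity is finite, there are only
  finitely many points, and the remaining members of the sequence are \<open>\<infinity>\<close>. The law of
  the increments is written out because \<open>poisson_pmf\<close> requires a positive rate.
\<close>

definition poisson_process ::
  "'w measure \<Rightarrow> (real \<Rightarrow> real) \<Rightarrow> (nat \<Rightarrow> 'w \<Rightarrow> ereal) \<Rightarrow> bool" where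
  "poisson_process M lam \<tau> \<longleftrightarrow>
     (\<forall>s\<ge>0. 0 \<le> lam s) \<and> (\<forall>t\<ge>0. set_integrable lborel {0..t} lam) \<and>
     (\<forall>i\<ge>1. \<tau> i \<in> borel_measurable M) \<and>
     (\<forall>\<omega>\<in>space M. \<forall>i\<ge>1. 0 \<le> \<tau> i \<omega> \<and> \<tau> i \<omega> \<le> \<tau> (Suc i) \<omega>) \<and>
     (\<forall>\<omega>\<in>space M. \<forall>t. finite {i. 1 \<le> i \<and> \<tau> i \<omega> \<le> ereal t}) \<and>
     (AE \<omega> in M. counting \<tau> 0 \<omega> = 0) \<and>
     (\<forall>t. 0 \<le> t 0 \<and> incseq t \<longrightarrow>
        prob_space.indep_vars M (\<lambda>_. count_space UNIV)
          (\<lambda>k \<omega>. counting \<tau> (t (Suc k)) \<omega> - counting \<tau> (t k) \<omega>) (UNIV :: nat set)) \<and>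
     (\<forall>s t k. 0 \<le> s \<and> s \<le> t \<longrightarrow>
        (let \<mu> = cumulative_intensity lam t - cumulative_intensity lam s in
         measure M {\<omega>\<in>space M. counting \<tau> t \<omega> - counting \<tau> s \<omega> = k} =
           exp (- \<mu>) * \<mu> ^ k / fact k))"

definition shot_noise ::
  "(nat \<Rightarrow> 'w \<Rightarrow> real) \<Rightarrow> (nat \<Rightarrow> 'w \<Rightarrow> real \<Rightarrow> real \<Rightarrow> real) \<Rightarrow> (nat \<Rightarrow> 'w \<Rightarrow> ereal) \<Rightarrow>
   real \<Rightarrow> 'w \<Rightarrow> real" where
  "shot_noise X h \<tau> t \<omega> = (\<Sum>i=1..counting \<tau> t \<omega>. X i \<omega> * h i \<omega> t (real_of_ereal (\<tau> i \<omega>)))"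

text \<open>
  \<open>K\<close> is the sigma-algebra on the space of shock functions. The shocks are independent of the
  pair of sequences of shock functions and instants.
\<close>

definition shot_noise_model ::
  "'w measure \<Rightarrow> (real \<Rightarrow> real \<Rightarrow> real) measure \<Rightarrow> (real \<Rightarrow> real) \<Rightarrow> (nat \<Rightarrow> 'w \<Rightarrow> real) \<Rightarrow>
   (nat \<Rightarrow> 'w \<Rightarrow> real \<Rightarrow> real \<Rightarrow> real) \<Rightarrow> (nat \<Rightarrow> 'w \<Rightarrow> ereal) \<Rightarrow> bool" where
  "shot_noise_model M K lam X h \<tau> \<longleftrightarrow>
     prob_space M \<and>
     (\<forall>i\<ge>1. X i \<in> borel_measurable M \<and> (\<forall>\<omega>\<in>space M. 0 \<le> X i \<omega>)) \<and>
     (\<lambda>(f, t, s). f t s) \<in> borel_measurable (K \<Otimes>\<^sub>M borel \<Otimes>\<^sub>M borel) \<and>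
     iid M K h \<and>
     (\<forall>i\<ge>1. \<forall>\<omega>\<in>space M. \<forall>t\<ge>0. \<forall>s\<ge>0. 0 \<le> h i \<omega> t s) \<and>
     poisson_process M lam \<tau> \<and>
     indep_elements M
       (Pi\<^sub>M {1..} (\<lambda>_. borel)) (random_sequence X)
       (Pi\<^sub>M {1..} (\<lambda>_. K) \<Otimes>\<^sub>M Pi\<^sub>M {1..} (\<lambda>_. borel))
       (\<lambda>\<omega>. (random_sequence h \<omega>, random_sequence \<tau> \<omega>))"

definition tail :: "'w measure \<Rightarrow> ('w \<Rightarrow> real) \<Rightarrow> real \<Rightarrow> real" where
  "tail M Z x = measure M {\<omega>\<in>space M. Z \<omega> > x}"

definition integrated_tail :: "'w measure \<Rightarrow> ('w \<Rightarrow> real) \<Rightarrow> real \<Rightarrow> real" where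
  "integrated_tail M Z y = (1 / integral\<^sup>L M Z) * (LBINT x:{y..}. tail M Z x)"

definition regularly_varying :: "(real \<Rightarrow> real) \<Rightarrow> real \<Rightarrow> bool" where
  "regularly_varying f \<rho> \<longleftrightarrow>
     f \<in> borel_measurable borel \<and> (\<forall>\<^sub>F x in at_top. 0 < f x) \<and>
     (\<forall>c>0. ((\<lambda>x. f (c * x) / f x) \<longlongrightarrow> c powr \<rho>) at_top)"

definition expected_severity :: "'w measure \<Rightarrow> ('w \<Rightarrow> real) \<Rightarrow> real \<Rightarrow> real" where
  "expected_severity M Z x = integral\<^sup>L M (\<lambda>\<omega>. max 0 (Z \<omega> - x))"

end

theory Submission
  imports Defs
begin

text \<open>
  Given the marks \<open>W i = h i T (\<tau> i)\<close> and the number \<open>N\<close> of points, which are independent of the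
  shocks, the asymptotic independence of the shocks makes the weighted sum \<open>\<Sum>i\<le>N. W i * X i\<close>
  exceed a high level through a single large term, so its tail is asymptotic to
  \<open>(\<Sum>i\<le>N. W i powr \<alpha>)\<close> times the tail of \<open>X 1\<close>. A Potter-type bound dominates the ratio of the
  two tails by a multiple of \<open>\<Sum>i\<le>N. exp p ^ N * (1 + W i powr p)\<close>, which is integrable by
  Campbell's formula weighted by \<open>c ^ N\<close>, since \<open>N\<close> has exponential moments. Dominated convergence and
  Campbell's formula with \<open>c = 1\<close> give the tail of the shot noise, and integrating the tails over
  \<open>[x, \<infinity>)\<close> gives the expected severity.
\<close>

section \<open>Tails and expected severity\<close>

text \<open>The shocks may depend on one another, so bounds for sums of independent heavy-tailed
  variables do not apply. Domination in the number of terms comes from a crude remark instead: a sum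
  of \<open>n\<close> terms that exceeds \<open>x\<close> has a term exceeding \<open>x / n\<close>.
  By the Potter-type bound this costs a factor of order \<open>n powr p\<close>, which is enlarged
  to \<open>exp p ^ n\<close> because powers \<open>c ^ N\<close> are the weights for which
  Campbell's formula has a closed form. The weight cannot be split off from the sum over the marks,
  since that sum has \<open>N\<close> terms itself; this is why the formula is needed with
  \<open>c ^ N\<close> inside the expectation. Its proof rests on independent increments: when the
  points beyond a level \<open>a\<close> are counted, \<open>c ^ N\<close> factors over the two
  sides of \<open>a\<close>, and the counts on half-lines determine the measure. The conditional law
  of the points given \<open>N\<close> never appears. The gap between \<open>\<alpha>\<close> and
  \<open>p\<close> pays for uniformity: \<open>2 powr \<alpha> < 2 powr p\<close> turns a limit into
  an inequality that can be iterated.\<close>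

lemma indep_elements_nn_integral:
  assumes "prob_space M" and ind: "indep_elements M A X B Y"
    and f [measurable]: "f \<in> borel_measurable (A \<Otimes>\<^sub>M B)"
  shows "(\<integral>\<^sup>+\<omega>. f (X \<omega>, Y \<omega>) \<partial>M) = (\<integral>\<^sup>+\<omega>'. \<integral>\<^sup>+\<omega>. f (X \<omega>, Y \<omega>') \<partial>M \<partial>M)"
proof -
  interpret prob_space M by fact
  have X [measurable]: "X \<in> measurable M A" and Y [measurable]: "Y \<in> measurable M B"
    and indep: "indep_set {X -` a \<inter> space M | a. a \<in> sets A} {Y -` b \<inter> space M | b. b \<in> sets B}"
    using ind by (auto simp: indep_elements_def)
  interpret PX: prob_space "distr M A X" by (rule prob_space_distr) fact
  interpret PY: prob_space "distr M B Y" by (rule prob_space_distr) fact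
  interpret P: pair_sigma_finite "distr M A X" "distr M B Y" ..
  \<comment> \<open>The joint law is the product of the marginal laws: independence gives agreement
    on rectangles, which determine a product of sigma-finite measures. Tonelli does the
    rest.\<close>
  have eq: "distr M A X \<Otimes>\<^sub>M distr M B Y = distr M (A \<Otimes>\<^sub>M B) (\<lambda>\<omega>. (X \<omega>, Y \<omega>))"
  proof (rule pair_measure_eqI)
    fix a b assume "a \<in> sets (distr M A X)" "b \<in> sets (distr M B Y)"
    then have a [measurable]: "a \<in> sets A" and b [measurable]: "b \<in> sets B" by auto
    have "prob ((X -` a \<inter> space M) \<inter> (Y -` b \<inter> space M)) =
        prob (X -` a \<inter> space M) * prob (Y -` b \<inter> space M)"
      using indep a b by (intro indep_setD) auto
    moreover have "(\<lambda>\<omega>. (X \<omega>, Y \<omega>)) -` (a \<times> b) \<inter> space M =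
        (X -` a \<inter> space M) \<inter> (Y -` b \<inter> space M)"
      by auto
    ultimately show "emeasure (distr M A X) a * emeasure (distr M B Y) b =
        emeasure (distr M (A \<Otimes>\<^sub>M B) (\<lambda>\<omega>. (X \<omega>, Y \<omega>))) (a \<times> b)"
      by (simp add: emeasure_distr emeasure_eq_measure ennreal_mult[symmetric])
  qed (auto intro: PX.sigma_finite_measure_axioms PY.sigma_finite_measure_axioms sets_pair_measure_cong)
  have "(\<integral>\<^sup>+\<omega>. f (X \<omega>, Y \<omega>) \<partial>M) = (\<integral>\<^sup>+z. f z \<partial>(distr M A X \<Otimes>\<^sub>M distr M B Y))"
    unfolding eq by (simp add: nn_integral_distr)
  also have "\<dots> = (\<integral>\<^sup>+y. \<integral>\<^sup>+x. f (x, y) \<partial>distr M A X \<partial>distr M B Y)"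
    by (rule P.nn_integral_snd[symmetric]) simp
  also have "\<dots> = (\<integral>\<^sup>+y. \<integral>\<^sup>+\<omega>. f (X \<omega>, y) \<partial>M \<partial>distr M B Y)"
    by (intro nn_integral_cong, subst nn_integral_distr)
      (auto intro: measurable_compose[OF _ f] X measurable_Pair1')
  also have "\<dots> = (\<integral>\<^sup>+\<omega>'. \<integral>\<^sup>+\<omega>. f (X \<omega>, Y \<omega>') \<partial>M \<partial>M)"
    by (rule nn_integral_distr) auto
  finally show ?thesis .
qed

text \<open>Layer-cake formula: the excess over \<open>x\<close> is the length of
  \<open>{x..<Y \<omega>}\<close>, and Tonelli moves the integral over the level \<open>u\<close>
  outside.\<close>

lemma nn_integral_excess:
  assumes "prob_space M" and Y [measurable]: "Y \<in> borel_measurable M"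
  shows "(\<integral>\<^sup>+\<omega>. ennreal (max 0 (Y \<omega> - x)) \<partial>M) =
    (\<integral>\<^sup>+u. ennreal (indicator {x..} u * tail M Y u) \<partial>lborel)"
proof -
  interpret prob_space M by fact
  interpret pair_sigma_finite lborel M ..
  have "(\<integral>\<^sup>+\<omega>. ennreal (max 0 (Y \<omega> - x)) \<partial>M) =
      (\<integral>\<^sup>+\<omega>. \<integral>\<^sup>+u. indicator {x..} u * indicator {u. u < Y \<omega>} u \<partial>lborel \<partial>M)"
  proof (rule nn_integral_cong)
    fix \<omega>
    have "(\<integral>\<^sup>+u. indicator {x..} u * indicator {u. u < Y \<omega>} u \<partial>lborel) =
        (\<integral>\<^sup>+u. indicator {x..<Y \<omega>} u \<partial>lborel)"
      by (rule nn_integral_cong) (auto split: split_indicator)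
    then show "ennreal (max 0 (Y \<omega> - x)) =
        (\<integral>\<^sup>+u. indicator {x..} u * indicator {u. u < Y \<omega>} u \<partial>lborel)"
      by (cases "x \<le> Y \<omega>") (auto simp: max_def)
  qed
  also have "\<dots> = (\<integral>\<^sup>+u. \<integral>\<^sup>+\<omega>. indicator {x..} u * indicator {u. u < Y \<omega>} u \<partial>M \<partial>lborel)"
    by (rule Fubini') (simp add: split_beta')
  also have "\<dots> = (\<integral>\<^sup>+u. ennreal (indicator {x..} u * tail M Y u) \<partial>lborel)"
  proof (rule nn_integral_cong)
    fix u :: real
    have "(\<integral>\<^sup>+\<omega>. indicator {x..} u * indicator {u. u < Y \<omega>} u \<partial>M) =
        (\<integral>\<^sup>+\<omega>. indicator {x..} u * indicator {\<omega> \<in> space M. u < Y \<omega>} \<omega> \<partial>M)"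
      by (rule nn_integral_cong) (auto split: split_indicator)
    also have "\<dots> = indicator {x..} u * emeasure M {\<omega> \<in> space M. u < Y \<omega>}"
      by (subst nn_integral_cmult) auto
    finally show "(\<integral>\<^sup>+\<omega>. indicator {x..} u * indicator {u. u < Y \<omega>} u \<partial>M) =
        ennreal (indicator {x..} u * tail M Y u)"
      by (simp add: tail_def emeasure_eq_measure split: split_indicator)
  qed
  finally show ?thesis .
qed

lemma tail_antimono:
  assumes "prob_space M" and [measurable]: "Y \<in> borel_measurable M" and "x \<le> y"
  shows "tail M Y y \<le> tail M Y x"
proof -
  interpret prob_space M by fact
  show ?thesis unfolding tail_def using \<open>x \<le> y\<close> by (intro finite_measure_mono) auto
qed

lemma tail_measurable [measurable]:
  assumes "prob_space M" and "Y \<in> borel_measurable M"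
  shows "tail M Y \<in> borel_measurable borel"
proof -
  have "mono (\<lambda>x. - tail M Y x)" by (intro monoI) (simp add: tail_antimono[OF assms])
  then have "(\<lambda>x. - tail M Y x) \<in> borel_measurable borel" by (rule borel_measurable_mono)
  then show ?thesis by simp
qed

lemma tail_nonneg: "0 \<le> tail M Y x"
  by (simp add: tail_def)

text \<open>Both sides are \<open>enn2real\<close> of the same nonnegative integral. They agree even
  when the mean excess is infinite, both being the default value 0 then.\<close>

lemma expected_severity_eq_integral_tail:
  assumes "prob_space M" and Y [measurable]: "Y \<in> borel_measurable M"
  shows "expected_severity M Y x = (LBINT u:{x..}. tail M Y u)"
proof -
  note [measurable] = tail_measurable[OF assms]
  have "expected_severity M Y x = enn2real (\<integral>\<^sup>+\<omega>. ennreal (max 0 (Y \<omega> - x)) \<partial>M)"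
    unfolding expected_severity_def by (rule integral_eq_nn_integral) auto
  also have "\<dots> = (LBINT u:{x..}. tail M Y u)"
    unfolding nn_integral_excess[OF assms] set_lebesgue_integral_def
    by (subst integral_eq_nn_integral) (auto simp: tail_nonneg)
  finally show ?thesis .
qed

lemma set_integrable_tail:
  assumes "prob_space M" and "integrable M Y"
  shows "set_integrable lborel {x..} (tail M Y)"
proof -
  interpret prob_space M by fact
  have Y [measurable]: "Y \<in> borel_measurable M" using assms by auto
  note [measurable] = tail_measurable[OF \<open>prob_space M\<close> Y]
  have "integrable M (\<lambda>\<omega>. max 0 (Y \<omega> - x))" using assms by auto
  then have "(\<integral>\<^sup>+\<omega>. ennreal (max 0 (Y \<omega> - x)) \<partial>M) < \<infinity>"
    by (simp add: integrable_iff_bounded)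
  then show ?thesis
    unfolding nn_integral_excess[OF \<open>prob_space M\<close> Y] set_integrable_def
    by (intro integrableI_bounded) (auto simp: tail_nonneg)
qed

text \<open>Needed for dividing by the integrated tail. As the tail decreases, the stretch from
  \<open>x\<close> to \<open>x + 1\<close> alone contributes at least
  \<open>tail M Y (x + 1)\<close>.\<close>

lemma integral_tail_pos:
  assumes "prob_space M" and "integrable M Y" and pos: "\<And>u. 0 < tail M Y u"
  shows "0 < (LBINT u:{x..}. tail M Y u)"
proof -
  have "0 < tail M Y (x + 1)" by fact
  also have "\<dots> = (LBINT u:{x..x+1}. tail M Y (x + 1))" by (simp add: set_integral_const)
  also have "\<dots> \<le> (LBINT u:{x..x+1}. tail M Y u)"
    using assms
    by (intro set_integral_mono set_integrable_subset[OF set_integrable_tail[OF assms(1,2), of x]]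
        tail_antimono) (auto simp: set_integrable_def)
  also have "\<dots> \<le> (LBINT u:{x..}. tail M Y u)"
    unfolding set_lebesgue_integral_def
    using set_integrable_tail[OF assms(1,2), of x]
      set_integrable_subset[OF set_integrable_tail[OF assms(1,2), of x], of "{x..x+1}"]
    by (intro integral_mono) (auto simp: set_integrable_def tail_nonneg split: split_indicator)
  finally show ?thesis .
qed

text \<open>A pointwise bound of the error by \<open>e / 2 * tail M Z u\<close> beyond a fixed
  \<open>x0\<close> survives integration over every \<open>{x..}\<close> with
  \<open>x0 \<le> x\<close>. Halving \<open>e\<close> restores the strict inequality, and bounding
  the difference instead of the quotient treats \<open>c = 0\<close> like any other limit.\<close>

lemma expected_severity_asymptotics:
  assumes "prob_space M" and Y [measurable]: "Y \<in> borel_measurable M" and Z: "integrable M Z"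
    and pos: "\<And>u. 0 < tail M Z u"
    and lim: "((\<lambda>x. tail M Y x / tail M Z x) \<longlongrightarrow> c) at_top"
  shows "((\<lambda>x. expected_severity M Y x / (LBINT u:{x..}. tail M Z u)) \<longlongrightarrow> c) at_top"
proof (rule tendstoI)
  fix e :: real assume "0 < e"
  have [measurable]: "Z \<in> borel_measurable M" using Z by auto
  note [measurable] = tail_measurable[OF \<open>prob_space M\<close> Y] tail_measurable[OF \<open>prob_space M\<close>, of Z]
  from tendstoD[OF lim, of "e / 2"] \<open>0 < e\<close> obtain x0
    where x0: "\<And>u. x0 \<le> u \<Longrightarrow> dist (tail M Y u / tail M Z u) c < e / 2"
    by (auto simp: eventually_at_top_linorder)
  have bd: "\<bar>tail M Y u - c * tail M Z u\<bar> \<le> e / 2 * tail M Z u" if "x0 \<le> u" for u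
  proof -
    have "tail M Y u - c * tail M Z u = (tail M Y u / tail M Z u - c) * tail M Z u"
      using pos[of u] by (simp add: field_simps)
    also have "\<bar>\<dots>\<bar> = \<bar>tail M Y u / tail M Z u - c\<bar> * tail M Z u"
      using pos[of u] by (simp add: abs_mult)
    also have "\<dots> \<le> e / 2 * tail M Z u"
      using x0[OF that] pos[of u] by (intro mult_right_mono) (auto simp: dist_real_def)
    finally show ?thesis .
  qed
  have "dist (expected_severity M Y x / (LBINT u:{x..}. tail M Z u)) c < e" if "x0 \<le> x" for x
  proof -
    let ?I = "LBINT u:{x..}. tail M Z u"
    note iZ = set_integrable_tail[OF \<open>prob_space M\<close> Z, of x]
    \<comment> \<open>Integrability of \<open>tail M Y\<close> on \<open>{x..}\<close> is a
      by-product: the difference is dominated by a multiple of \<open>tail M Z\<close>, and adding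
      back \<open>c * tail M Z\<close> gives an integrable function.\<close>
    have iD: "set_integrable lborel {x..} (\<lambda>u. tail M Y u - c * tail M Z u)"
      unfolding set_integrable_def
    proof (rule Bochner_Integration.integrable_bound)
      show "integrable lborel (\<lambda>u. e / 2 * (indicator {x..} u *\<^sub>R tail M Z u))"
        using iZ by (auto simp: set_integrable_def)
      show "AE u in lborel. norm (indicator {x..} u *\<^sub>R (tail M Y u - c * tail M Z u)) \<le>
          norm (e / 2 * (indicator {x..} u *\<^sub>R tail M Z u))"
        using bd that \<open>0 < e\<close> by (auto simp: abs_mult tail_nonneg split: split_indicator)
    qed simp
    have "(LBINT u:{x..}. tail M Y u) =
        (LBINT u:{x..}. (tail M Y u - c * tail M Z u) + c * tail M Z u)" by simp
    also have "\<dots> = (LBINT u:{x..}. tail M Y u - c * tail M Z u) + c * ?I"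
      by (subst set_integral_add) (use iD iZ in auto)
    finally have "(LBINT u:{x..}. tail M Y u) - c * ?I =
        (LBINT u:{x..}. tail M Y u - c * tail M Z u)" by simp
    also have "\<bar>\<dots>\<bar> \<le> (LBINT u:{x..}. e / 2 * tail M Z u)"
    proof -
      have "norm (LBINT u:{x..}. tail M Y u - c * tail M Z u) \<le>
          (LBINT u:{x..}. norm (tail M Y u - c * tail M Z u))"
        using iD by (rule set_integral_norm_bound)
      also have "\<dots> \<le> (LBINT u:{x..}. e / 2 * tail M Z u)"
        using iD iZ bd that by (intro set_integral_mono set_integrable_norm) auto
      finally show ?thesis by simp
    qed
    also have "\<dots> = e / 2 * ?I" by simp
    finally have *: "\<bar>(LBINT u:{x..}. tail M Y u) - c * ?I\<bar> \<le> e / 2 * ?I" .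
    have I: "0 < ?I" by (rule integral_tail_pos[OF \<open>prob_space M\<close> Z pos])
    have "\<bar>expected_severity M Y x / ?I - c\<bar> =
        \<bar>(LBINT u:{x..}. tail M Y u) - c * ?I\<bar> / ?I"
      using I expected_severity_eq_integral_tail[OF \<open>prob_space M\<close> Y]
      by (simp add: abs_divide[symmetric] field_simps)
    also have "\<dots> \<le> e / 2" using * I by (simp add: field_simps)
    also have "\<dots> < e" using \<open>0 < e\<close> by simp
    finally show ?thesis by (simp add: dist_real_def)
  qed
  then show "\<forall>\<^sub>F x in at_top. dist (expected_severity M Y x / (LBINT u:{x..}. tail M Z u)) c < e"
    by (auto simp: eventually_at_top_linorder)
qed

section \<open>Weighted sums of shocks with regularly varying tails\<close>

text \<open>Bonferroni's inequality, with each pair counted twice; the weaker constant is harmless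
  because the pair terms will be negligible. In the induction, the overlap of \<open>A k\<close>
  with the old union is paid for by the new row \<open>k\<close> of the double sum.\<close>

lemma (in prob_space) sum_prob_le_prob_Union_plus_pairs:
  assumes "finite I" and "\<And>i. i \<in> I \<Longrightarrow> A i \<in> events"
  shows "(\<Sum>i\<in>I. prob (A i)) \<le> prob (\<Union>i\<in>I. A i) + (\<Sum>i\<in>I. \<Sum>j\<in>I - {i}. prob (A i \<inter> A j))"
  using assms
proof (induction I rule: finite_induct)
  case (insert k I)
  let ?U = "\<Union>i\<in>I. A i"
  have U: "?U \<in> events" using insert by auto
  have "prob (A k \<inter> ?U) = prob (\<Union>j\<in>I. A k \<inter> A j)" by (rule arg_cong[where f = prob]) auto
  also have "\<dots> \<le> (\<Sum>j\<in>I. prob (A k \<inter> A j))"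
    using insert by (intro finite_measure_subadditive_finite) auto
  finally have 1: "prob (A k \<inter> ?U) \<le> (\<Sum>j\<in>I. prob (A k \<inter> A j))" .
  have 2: "prob (A k \<union> ?U) = prob (A k) + prob ?U - prob (A k \<inter> ?U)"
    using insert.prems U by (intro measure_Un3) (auto simp: fmeasurable_eq_sets)
  have 3: "(\<Sum>i\<in>I. \<Sum>j\<in>I - {i}. prob (A i \<inter> A j)) \<le>
      (\<Sum>i\<in>I. \<Sum>j\<in>insert k I - {i}. prob (A i \<inter> A j))"
    using insert.hyps by (intro sum_mono sum_mono2) auto
  have 4: "insert k I - {k} = I" using insert.hyps by auto
  have IH: "(\<Sum>i\<in>I. prob (A i)) \<le> prob ?U + (\<Sum>i\<in>I. \<Sum>j\<in>I - {i}. prob (A i \<inter> A j))"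
    using insert by auto
  have "(\<Sum>i\<in>insert k I. prob (A i)) = prob (A k) + (\<Sum>i\<in>I. prob (A i))"
    using insert.hyps by simp
  also have "\<dots> \<le> prob (A k \<union> ?U) + ((\<Sum>j\<in>I. prob (A k \<inter> A j)) +
      (\<Sum>i\<in>I. \<Sum>j\<in>insert k I - {i}. prob (A i \<inter> A j)))"
    using 1 2 3 IH by linarith
  also have "\<dots> = prob (\<Union>i\<in>insert k I. A i) +
      (\<Sum>i\<in>insert k I. \<Sum>j\<in>insert k I - {i}. prob (A i \<inter> A j))"
    using insert.hyps 4 by simp
  finally show ?case .
qed simp

text \<open>If the largest term \<open>y k\<close> is at most \<open>(1 - \<delta>) * x\<close>, the
  others add up to more than \<open>\<delta> * x\<close>, so one of them exceeds the average
  \<open>\<delta> * x / card I\<close>, and \<open>y k\<close> exceeds it too.\<close>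

lemma one_big_jump:
  fixes y :: "'i \<Rightarrow> real"
  assumes "finite I" and x: "0 < x" and \<delta>: "0 < \<delta>" "\<delta> < 1" and sum: "x < (\<Sum>i\<in>I. y i)"
  shows "(\<exists>i\<in>I. (1 - \<delta>) * x < y i) \<or>
    (\<exists>i\<in>I. \<exists>j\<in>I - {i}. \<delta> * x / card I < y i \<and> \<delta> * x / card I < y j)"
proof -
  have "I \<noteq> {}" using sum x by auto
  then have "Max (y ` I) \<in> y ` I" using \<open>finite I\<close> by (intro Max_in) auto
  then obtain k where "k \<in> I" and "Max (y ` I) = y k" by auto
  then have k: "k \<in> I" "\<forall>i\<in>I. y i \<le> y k"
    using \<open>finite I\<close> Max_ge[of "y ` I"] by fastforce+
  show ?thesis
  proof (cases "(1 - \<delta>) * x < y k")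
    case False
    have c: "0 < card I" using \<open>I \<noteq> {}\<close> \<open>finite I\<close> by (simp add: card_gt_0_iff)
    have "\<exists>j\<in>I - {k}. \<delta> * x / card I < y j"
    proof (rule ccontr)
      assume "\<not> (\<exists>j\<in>I - {k}. \<delta> * x / card I < y j)"
      then have "(\<Sum>i\<in>I - {k}. y i) \<le> real (card (I - {k})) * (\<delta> * x / card I)"
        by (intro sum_bounded_above) (auto simp: not_less)
      also have "\<dots> \<le> real (card I) * (\<delta> * x / card I)"
        using \<delta> x c k \<open>finite I\<close> by (intro mult_right_mono) auto
      also have "\<dots> = \<delta> * x" using c by simp
      finally have "(\<Sum>i\<in>I. y i) \<le> y k + \<delta> * x"
        using k \<open>finite I\<close> by (simp add: sum.remove)
      with False sum show False by (simp add: algebra_simps)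
    qed
    then obtain j where j: "j \<in> I - {k}" "\<delta> * x / card I < y j" ..
    moreover have "y j \<le> y k" using j k by blast
    ultimately show ?thesis using k(1) less_le_trans by blast
  next
    case True
    then show ?thesis using \<open>k \<in> I\<close> by blast
  qed
qed

section \<open>Tails of scaled shocks, singly and in pairs\<close>

lemma regularly_varying_limit:
  "regularly_varying F \<rho> \<Longrightarrow> 0 < c \<Longrightarrow> ((\<lambda>x. F (c * x) / F x) \<longlongrightarrow> c powr \<rho>) at_top"
  by (simp add: regularly_varying_def)

lemma tail_scaled_limit:
  fixes F :: "real \<Rightarrow> real"
  assumes rv: "regularly_varying F (- \<alpha>)" and w: "0 \<le> w"
    and F: "\<And>x. measure M {\<omega>\<in>space M. X \<omega> > x} = F x"
  shows "((\<lambda>x. measure M {\<omega>\<in>space M. w * X \<omega> > x} / F x) \<longlongrightarrow> w powr \<alpha>) at_top"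
proof (cases "w = 0")
  \<comment> \<open>With weight 0 the event is empty once \<open>x \<ge> 0\<close>, which matches
    the convention \<open>0 powr \<alpha> = 0\<close>.\<close>
  case True
  have "\<forall>\<^sub>F x in at_top. measure M {\<omega>\<in>space M. w * X \<omega> > x} / F x = 0"
    using eventually_ge_at_top[of 0] by eventually_elim (auto simp: True)
  then show ?thesis by (simp add: True tendsto_eventually)
next
  case False
  with w have "0 < w" by simp
  have "measure M {\<omega>\<in>space M. w * X \<omega> > x} = F (1 / w * x)" for x
  proof -
    have "{\<omega>\<in>space M. w * X \<omega> > x} = {\<omega>\<in>space M. X \<omega> > 1 / w * x}"
      using \<open>0 < w\<close> by (auto simp: field_simps)
    then show ?thesis using F by simp
  qed
  moreover have "(1 / w) powr - \<alpha> = w powr \<alpha>"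
    using \<open>0 < w\<close> by (simp add: powr_divide powr_minus_divide)
  moreover have "((\<lambda>x. F (1 / w * x) / F x) \<longlongrightarrow> (1 / w) powr - \<alpha>) at_top"
    using rv \<open>0 < w\<close> by (intro regularly_varying_limit) auto
  ultimately show ?thesis by simp
qed

text \<open>Both weights are raised to a common \<open>u\<close>, kept positive by the 1 in its
  definition; this only enlarges the event because the variables are nonnegative. The ratio then
  factors as \<open>J (x / u) / F (x / u)\<close>, which tends to 0, times
  \<open>F (x / u) / F x\<close>, which converges by regular variation.\<close>

lemma joint_tail_scaled_limit:
  fixes F :: "real \<Rightarrow> real"
  assumes "prob_space M" and [measurable]: "X \<in> borel_measurable M" "Y \<in> borel_measurable M"
    and nonneg: "\<And>\<omega>. \<omega> \<in> space M \<Longrightarrow> 0 \<le> X \<omega>" "\<And>\<omega>. \<omega> \<in> space M \<Longrightarrow> 0 \<le> Y \<omega>"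
    and rv: "regularly_varying F (- \<alpha>)"
    and lim: "((\<lambda>x. measure M {\<omega>\<in>space M. X \<omega> > x \<and> Y \<omega> > x} / F x) \<longlongrightarrow> 0) at_top"
  shows "((\<lambda>x. measure M {\<omega>\<in>space M. v * X \<omega> > x \<and> w * Y \<omega> > x} / F x) \<longlongrightarrow> 0) at_top"
proof -
  interpret prob_space M by fact
  define u where "u = max 1 (max v w)"
  have u: "0 < u" "v \<le> u" "w \<le> u" by (auto simp: u_def)
  define J where "J x = prob {\<omega>\<in>space M. X \<omega> > x \<and> Y \<omega> > x}" for x
  have pos: "\<forall>\<^sub>F x in at_top. 0 < F x" using rv by (auto simp: regularly_varying_def)
  have scale: "filterlim (\<lambda>x. 1 / u * x) at_top at_top"
    using u by (intro filterlim_tendsto_pos_mult_at_top[OF tendsto_const] filterlim_ident) auto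
  have "((\<lambda>x. J (1 / u * x) / F (1 / u * x)) \<longlongrightarrow> 0) at_top"
    using filterlim_compose[OF lim scale] by (simp add: J_def)
  moreover have "((\<lambda>x. F (1 / u * x) / F x) \<longlongrightarrow> (1 / u) powr - \<alpha>) at_top"
    using rv u by (intro regularly_varying_limit) auto
  ultimately have "((\<lambda>x. J (1 / u * x) / F (1 / u * x) * (F (1 / u * x) / F x)) \<longlongrightarrow> 0) at_top"
    using tendsto_mult[of _ 0] by fastforce
  moreover have "\<forall>\<^sub>F x in at_top.
      J (1 / u * x) / F (1 / u * x) * (F (1 / u * x) / F x) = J (1 / u * x) / F x"
    using eventually_compose_filterlim[OF pos scale] by eventually_elim auto
  ultimately have lim': "((\<lambda>x. J (1 / u * x) / F x) \<longlongrightarrow> 0) at_top"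
    by (rule Lim_transform_eventually)
  show ?thesis
  proof (rule tendsto_sandwich[OF _ _ tendsto_const lim'])
    show "\<forall>\<^sub>F x in at_top. 0 \<le> prob {\<omega>\<in>space M. v * X \<omega> > x \<and> w * Y \<omega> > x} / F x"
      using pos by eventually_elim auto
    show "\<forall>\<^sub>F x in at_top. prob {\<omega>\<in>space M. v * X \<omega> > x \<and> w * Y \<omega> > x} / F x \<le> J (1 / u * x) / F x"
      using pos
    proof eventually_elim
      case (elim x)
      have "x < u * X \<omega> \<and> x < u * Y \<omega>"
        if "\<omega> \<in> space M" "x < v * X \<omega>" "x < w * Y \<omega>" for \<omega>
        using mult_right_mono[OF u(2) nonneg(1)[OF that(1)]]
          mult_right_mono[OF u(3) nonneg(2)[OF that(1)]] that by linarith
      then have "prob {\<omega>\<in>space M. v * X \<omega> > x \<and> w * Y \<omega> > x} \<le> J (1 / u * x)"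
        unfolding J_def using u(1) by (intro finite_measure_mono) (auto simp: field_simps)
      then show ?case using elim by (intro divide_right_mono) auto
    qed
  qed
qed

text \<open>From below, a single weighted shock above \<open>x\<close> already forces the sum above
  \<open>x\<close>, all terms being nonnegative, and Bonferroni's correction is negligible against
  \<open>F\<close>. From above, \<open>one_big_jump\<close> covers the event by exceedances of
  \<open>(1 - \<delta>) * x\<close> and joint exceedances, with \<open>\<delta>\<close> small. Since
  \<open>F\<close> is a separate parameter, the empty sum, which occurs when there are no points, is
  covered.\<close>

proposition tail_weighted_sum_limit:
  fixes F :: "real \<Rightarrow> real" and w :: "'i \<Rightarrow> real"
  assumes "prob_space M" and "finite I"
    and X [measurable]: "\<And>i. i \<in> I \<Longrightarrow> X i \<in> borel_measurable M"
    and nonneg: "\<And>i \<omega>. i \<in> I \<Longrightarrow> \<omega> \<in> space M \<Longrightarrow> 0 \<le> X i \<omega>"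
    and w: "\<And>i. i \<in> I \<Longrightarrow> 0 \<le> w i"
    and rv: "regularly_varying F (- \<alpha>)"
    and F: "\<And>i x. i \<in> I \<Longrightarrow> tail M (X i) x = F x"
    and pairs: "\<And>i j. i \<in> I \<Longrightarrow> j \<in> I \<Longrightarrow> i \<noteq> j \<Longrightarrow>
      ((\<lambda>x. measure M {\<omega>\<in>space M. X i \<omega> > x \<and> X j \<omega> > x} / F x) \<longlongrightarrow> 0) at_top"
  shows "((\<lambda>x. tail M (\<lambda>\<omega>. \<Sum>i\<in>I. w i * X i \<omega>) x / F x) \<longlongrightarrow> (\<Sum>i\<in>I. w i powr \<alpha>)) at_top"
proof -
  interpret prob_space M by fact
  define S where "S = (\<Sum>i\<in>I. w i powr \<alpha>)"
  define P where "P v i x = prob {\<omega>\<in>space M. v * X i \<omega> > x}" for v i x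
  define J where "J v i j x = prob {\<omega>\<in>space M. v i * X i \<omega> > x \<and> v j * X j \<omega> > x}" for v i j x
  define Q where "Q x = tail M (\<lambda>\<omega>. \<Sum>i\<in>I. w i * X i \<omega>) x" for x
  have pos: "\<forall>\<^sub>F x in at_top. 0 < F x" using rv by (auto simp: regularly_varying_def)
  have P: "((\<lambda>x. P v i x / F x) \<longlongrightarrow> v powr \<alpha>) at_top" if "i \<in> I" "0 \<le> v" for v i
    unfolding P_def using that F by (intro tail_scaled_limit rv) (auto simp: tail_def)
  have J: "((\<lambda>x. J v i j x / F x) \<longlongrightarrow> 0) at_top" if "i \<in> I" "j \<in> I - {i}" for v i j
    unfolding J_def using that
    by (intro joint_tail_scaled_limit[OF _ _ _ _ _ rv] pairs nonneg X \<open>prob_space M\<close>) auto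
  have lower: "\<forall>\<^sub>F x in at_top. a < Q x / F x" if "a < S" for a
  proof -
    have "((\<lambda>x. (\<Sum>i\<in>I. P (w i) i x / F x) - (\<Sum>i\<in>I. \<Sum>j\<in>I - {i}. J w i j x / F x)) \<longlongrightarrow>
        S - (\<Sum>i\<in>I. \<Sum>j\<in>I - {i}. 0)) at_top"
      unfolding S_def by (intro tendsto_diff tendsto_sum P J w) auto
    with that have "\<forall>\<^sub>F x in at_top.
        a < (\<Sum>i\<in>I. P (w i) i x / F x) - (\<Sum>i\<in>I. \<Sum>j\<in>I - {i}. J w i j x / F x)"
      by (intro order_tendstoD(1)) auto
    with pos show ?thesis
    proof eventually_elim
      case (elim x)
      define A where "A i = {\<omega>\<in>space M. w i * X i \<omega> > x}" for i
      have A: "A i \<in> events" if "i \<in> I" for i using that by (auto simp: A_def)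
      have "(\<Union>i\<in>I. A i) \<subseteq> {\<omega>\<in>space M. (\<Sum>i\<in>I. w i * X i \<omega>) > x}"
      proof safe
        fix i \<omega> assume i: "i \<in> I" "\<omega> \<in> A i"
        then have "x < w i * X i \<omega>" "\<omega> \<in> space M" by (auto simp: A_def)
        moreover have "w i * X i \<omega> \<le> (\<Sum>i\<in>I. w i * X i \<omega>)"
          using i \<open>finite I\<close> w nonneg \<open>\<omega> \<in> space M\<close> by (intro member_le_sum) auto
        ultimately show "x < (\<Sum>i\<in>I. w i * X i \<omega>)" by simp
      qed (auto simp: A_def)
      then have "prob (\<Union>i\<in>I. A i) \<le> Q x"
        unfolding Q_def tail_def by (intro finite_measure_mono) auto
      moreover have "(\<Sum>i\<in>I. prob (A i)) \<le> prob (\<Union>i\<in>I. A i) + (\<Sum>i\<in>I. \<Sum>j\<in>I - {i}. prob (A i \<inter> A j))"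
        using \<open>finite I\<close> A by (rule sum_prob_le_prob_Union_plus_pairs)
      moreover have "A i \<inter> A j = {\<omega>\<in>space M. w i * X i \<omega> > x \<and> w j * X j \<omega> > x}" for i j
        by (auto simp: A_def)
      ultimately have "(\<Sum>i\<in>I. P (w i) i x) - (\<Sum>i\<in>I. \<Sum>j\<in>I - {i}. J w i j x) \<le> Q x"
        by (simp add: P_def J_def A_def)
      then have "((\<Sum>i\<in>I. P (w i) i x) - (\<Sum>i\<in>I. \<Sum>j\<in>I - {i}. J w i j x)) / F x \<le> Q x / F x"
        using elim by (intro divide_right_mono) auto
      with elim show ?case by (simp add: diff_divide_distrib sum_divide_distrib)
    qed
  qed
  have upper: "\<forall>\<^sub>F x in at_top. Q x / F x < a" if "S < a" for a
  proof -
    have "((\<lambda>\<delta>. \<Sum>i\<in>I. (w i / (1 - \<delta>)) powr \<alpha>) \<longlongrightarrow> (\<Sum>i\<in>I. (w i / (1 - 0)) powr \<alpha>)) (at_right 0)"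
    proof (intro tendsto_sum)
      fix i assume "i \<in> I"
      show "((\<lambda>\<delta>. (w i / (1 - \<delta>)) powr \<alpha>) \<longlongrightarrow> (w i / (1 - 0)) powr \<alpha>) (at_right 0)"
      \<comment> \<open>The limit rule for \<open>powr\<close> asks for a nonzero limit of the base;
        for weight 0 the function is constant.\<close>
      proof (cases "w i = 0")
        case False
        then show ?thesis by (intro tendsto_intros) auto
      qed simp
    qed
    with that have "\<forall>\<^sub>F \<delta> in at_right 0. (\<Sum>i\<in>I. (w i / (1 - \<delta>)) powr \<alpha>) < a"
      by (intro order_tendstoD(2)) (auto simp: S_def)
    moreover have "\<forall>\<^sub>F \<delta>::real in at_right 0. 0 < \<delta> \<and> \<delta> < 1"
      by (auto simp: eventually_at_right[of 0 1] intro!: exI[of _ 1])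
    ultimately obtain \<delta> where \<delta>: "(\<Sum>i\<in>I. (w i / (1 - \<delta>)) powr \<alpha>) < a" "0 < \<delta>" "\<delta> < 1"
      using eventually_happens'[OF trivial_limit_at_right_real] eventually_conj by blast
    \<comment> \<open>With this weight \<open>\<delta> * x / card I < w i * X i\<close> reads
      \<open>x < v i * X i\<close>, so that the joint exceedances fall under the limit
      \<open>J\<close>, which is available for arbitrary weights.\<close>
    define v where "v i = card I * w i / \<delta>" for i
    have "((\<lambda>x. (\<Sum>i\<in>I. P (w i / (1 - \<delta>)) i x / F x) + (\<Sum>i\<in>I. \<Sum>j\<in>I - {i}. J v i j x / F x)) \<longlongrightarrow>
        (\<Sum>i\<in>I. (w i / (1 - \<delta>)) powr \<alpha>) + (\<Sum>i\<in>I. \<Sum>j\<in>I - {i}. 0)) at_top"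
      using \<delta> by (intro tendsto_add tendsto_sum P J divide_nonneg_pos w) auto
    with \<delta> have "\<forall>\<^sub>F x in at_top.
        (\<Sum>i\<in>I. P (w i / (1 - \<delta>)) i x / F x) + (\<Sum>i\<in>I. \<Sum>j\<in>I - {i}. J v i j x / F x) < a"
      by (intro order_tendstoD(2)) auto
    with pos eventually_gt_at_top[of 0] show ?thesis
    proof eventually_elim
      case (elim x)
      define A where "A i = {\<omega>\<in>space M. w i / (1 - \<delta>) * X i \<omega> > x}" for i
      define B where "B i j = {\<omega>\<in>space M. v i * X i \<omega> > x \<and> v j * X j \<omega> > x}" for i j
      have [measurable]: "A i \<in> events" if "i \<in> I" for i using that by (auto simp: A_def)
      have [measurable]: "B i j \<in> events" if "i \<in> I" "j \<in> I" for i j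
        using that by (auto simp: B_def)
      have "{\<omega>\<in>space M. (\<Sum>i\<in>I. w i * X i \<omega>) > x} \<subseteq> (\<Union>i\<in>I. A i) \<union> (\<Union>i\<in>I. \<Union>j\<in>I - {i}. B i j)"
      proof
        fix \<omega> assume \<omega>: "\<omega> \<in> {\<omega>\<in>space M. (\<Sum>i\<in>I. w i * X i \<omega>) > x}"
        then have "I \<noteq> {}" using elim by auto
        then have c: "0 < card I" using \<open>finite I\<close> by (simp add: card_gt_0_iff)
        have "(\<exists>i\<in>I. (1 - \<delta>) * x < w i * X i \<omega>) \<or> (\<exists>i\<in>I. \<exists>j\<in>I - {i}.
            \<delta> * x / card I < w i * X i \<omega> \<and> \<delta> * x / card I < w j * X j \<omega>)"
          using \<delta> elim \<omega> \<open>finite I\<close> by (intro one_big_jump) auto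
        moreover have "(1 - \<delta>) * x < w i * X i \<omega> \<longleftrightarrow> w i / (1 - \<delta>) * X i \<omega> > x" for i
          using \<delta> by (simp add: field_simps)
        moreover have "\<delta> * x / card I < w i * X i \<omega> \<longleftrightarrow> v i * X i \<omega> > x" for i
          using \<delta> c by (simp add: v_def field_simps)
        ultimately show "\<omega> \<in> (\<Union>i\<in>I. A i) \<union> (\<Union>i\<in>I. \<Union>j\<in>I - {i}. B i j)"
          using \<omega> by (auto simp: A_def B_def)
      qed
      then have "Q x \<le> prob ((\<Union>i\<in>I. A i) \<union> (\<Union>i\<in>I. \<Union>j\<in>I - {i}. B i j))"
        unfolding Q_def tail_def using \<open>finite I\<close>
        by (intro finite_measure_mono sets.Un sets.finite_UN) auto
      also have "\<dots> \<le> prob (\<Union>i\<in>I. A i) + prob (\<Union>i\<in>I. \<Union>j\<in>I - {i}. B i j)"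
        using \<open>finite I\<close> by (intro measure_Un_le sets.finite_UN) auto
      also have "\<dots> \<le> (\<Sum>i\<in>I. prob (A i)) + (\<Sum>i\<in>I. prob (\<Union>j\<in>I - {i}. B i j))"
        using \<open>finite I\<close> by (intro add_mono finite_measure_subadditive_finite) auto
      also have "\<dots> \<le> (\<Sum>i\<in>I. prob (A i)) + (\<Sum>i\<in>I. \<Sum>j\<in>I - {i}. prob (B i j))"
        using \<open>finite I\<close> by (intro add_left_mono sum_mono finite_measure_subadditive_finite) auto
      finally have "Q x \<le> (\<Sum>i\<in>I. P (w i / (1 - \<delta>)) i x) + (\<Sum>i\<in>I. \<Sum>j\<in>I - {i}. J v i j x)"
        by (simp add: P_def J_def A_def B_def)
      then have "Q x / F x \<le>
          ((\<Sum>i\<in>I. P (w i / (1 - \<delta>)) i x) + (\<Sum>i\<in>I. \<Sum>j\<in>I - {i}. J v i j x)) / F x"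
        using elim by (intro divide_right_mono) auto
      with elim show ?case by (simp add: add_divide_distrib sum_divide_distrib)
    qed
  qed
  show ?thesis
    using lower upper unfolding S_def Q_def by (rule order_tendstoI)
qed

text \<open>As \<open>F (x / 2) / F x\<close> tends to \<open>2 powr \<alpha> < 2 powr p\<close>,
  one halving of the argument costs at most \<open>2 powr p\<close> beyond \<open>x0\<close>, and
  about \<open>log 2 w\<close> halvings reach \<open>x / w\<close>. Unlike the usual Potter bound,
  this one does not ask \<open>x / w\<close> to stay large; \<open>F \<le> 1\<close> makes up for
  that. The summand 1 covers \<open>w \<le> 1\<close>, where monotonicity suffices.\<close>

lemma regularly_varying_scaling_bound:
  fixes F :: "real \<Rightarrow> real"
  assumes rv: "regularly_varying F (- \<alpha>)" and anti: "\<And>x y. x \<le> y \<Longrightarrow> F y \<le> F x"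
    and le1: "\<And>x. F x \<le> 1" and p: "0 < \<alpha>" "\<alpha> < p"
  obtains C x0 where "0 \<le> C" "0 < x0" "\<And>x. x0 \<le> x \<Longrightarrow> 0 < F x"
    "\<And>x w. x0 \<le> x \<Longrightarrow> 0 < w \<Longrightarrow> F (x / w) \<le> C * (1 + w powr p) * F x"
proof -
  have "((\<lambda>x. F (1 / 2 * x) / F x) \<longlongrightarrow> (1 / 2) powr - \<alpha>) at_top"
    using rv by (intro regularly_varying_limit) auto
  moreover have "(1 / 2) powr - \<alpha> < (2::real) powr p"
    using p by (simp add: powr_divide powr_minus_divide)
  ultimately have "\<forall>\<^sub>F x in at_top. F (1 / 2 * x) / F x < 2 powr p"
    by (rule order_tendstoD(2))
  moreover have "\<forall>\<^sub>F x in at_top. 0 < F x" using rv by (auto simp: regularly_varying_def)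
  ultimately have "\<forall>\<^sub>F x in at_top. 0 < F x \<and> F (x / 2) \<le> 2 powr p * F x"
    by eventually_elim (auto simp: field_simps)
  then obtain y where y: "\<And>x. y \<le> x \<Longrightarrow> 0 < F x \<and> F (x / 2) \<le> 2 powr p * F x"
    by (auto simp: eventually_at_top_linorder)
  define x0 where "x0 = max 1 y"
  have x0: "0 < x0" "0 < F x0" using y[of x0] by (auto simp: x0_def)
  have pos: "0 < F x" and half: "F (x / 2) \<le> 2 powr p * F x" if "x0 \<le> x" for x
    using y[of x] that by (auto simp: x0_def)
  \<comment> \<open>halving stops as soon as \<open>x / 2 < x0\<close>; from there on \<open>F \<le> 1 \<le> F (x / 2) / F x0\<close>\<close>
  have dyadic: "F (x / 2 ^ k) \<le> (2 powr p) ^ k * F x / F x0" if "x0 \<le> x" for x k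
    using that
  proof (induction k arbitrary: x)
    case 0
    then show ?case using pos[of x] le1[of x0] x0 by (simp add: field_simps)
  next
    case (Suc k)
    show ?case
    proof (cases "x0 \<le> x / 2")
      case True
      have "F (x / 2 ^ Suc k) = F (x / 2 / 2 ^ k)" by simp
      also have "\<dots> \<le> (2 powr p) ^ k * F (x / 2) / F x0" using True by (rule Suc.IH)
      also have "\<dots> \<le> (2 powr p) ^ k * (2 powr p * F x) / F x0"
        using half[OF Suc.prems] x0 by (intro divide_right_mono mult_left_mono) auto
      finally show ?thesis by (simp add: mult_ac)
    next
      case False
      have "F x0 \<le> F (x / 2)" using False by (intro anti) simp
      also have "\<dots> \<le> 2 powr p * F x" by (rule half) fact
      finally have "1 \<le> 2 powr p * F x / F x0" using x0 by simp
      moreover have "1 \<le> (2 powr p) ^ k" using p by (intro one_le_power ge_one_powr_ge_zero) auto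
      ultimately have "1 * 1 \<le> (2 powr p) ^ k * (2 powr p * F x / F x0)"
        by (intro mult_mono) auto
      then show ?thesis using le1[of "x / 2 ^ Suc k"] by (simp add: mult_ac)
    qed
  qed
  \<comment> \<open>The numerator is the price of rounding the number of halvings up to an integer,
    the denominator that of leaving the range \<open>x0 \<le> x\<close>.\<close>
  define C where "C = 2 powr p / F x0"
  have C: "1 \<le> C"
  proof -
    have "F x0 \<le> 1" by (rule le1)
    also have "1 \<le> 2 powr p" using p by (intro ge_one_powr_ge_zero) auto
    finally show ?thesis using x0 by (simp add: C_def)
  qed
  show ?thesis
  proof (rule that[of C x0])
    show "0 \<le> C" using C by simp
    fix x w :: real assume x: "x0 \<le> x" and w: "0 < w"
    show "F (x / w) \<le> C * (1 + w powr p) * F x"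
    proof (cases "w \<le> 1")
      case True
      have "F (x / w) \<le> F x" using True x x0 w by (intro anti) (simp add: field_simps)
      also have "\<dots> \<le> (C * (1 + w powr p)) * F x"
      proof -
        have "1 * 1 \<le> C * (1 + w powr p)" using C by (intro mult_mono) auto
        then show ?thesis using pos[OF x] by simp
      qed
      finally show ?thesis .
    next
      case False
      \<comment> \<open>The least number of halvings with \<open>w \<le> 2 ^ k\<close>; it exceeds
        \<open>log 2 w\<close> by at most one, hence the single extra factor
        \<open>2 powr p\<close>.\<close>
      define k where "k = nat \<lceil>log 2 w\<rceil>"
      have l: "0 < log 2 w" using False by simp
      have k: "log 2 w \<le> k" "k \<le> log 2 w + 1" using l by (auto simp: k_def)
      have "w = 2 powr log 2 w" using w by simp
      also have "\<dots> \<le> 2 powr k" using k by simp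
      also have "\<dots> = 2 ^ k" by (simp add: powr_realpow)
      finally have wk: "w \<le> 2 ^ k" .
      have wp: "w powr p = 2 powr (log 2 w * p)" using w by (simp flip: powr_powr)
      have "(2 powr p) ^ k = 2 powr (k * p)" by (simp add: powr_power)
      also have "\<dots> \<le> 2 powr ((log 2 w + 1) * p)" using p k by simp
      also have "\<dots> = 2 powr p * w powr p"
        by (simp add: distrib_right powr_add wp)
      finally have pk: "(2 powr p) ^ k \<le> 2 powr p * w powr p" .
      have "F (x / w) \<le> F (x / 2 ^ k)"
        using wk w x x0 by (intro anti divide_left_mono) auto
      also have "\<dots> \<le> (2 powr p) ^ k * F x / F x0" using x by (rule dyadic)
      also have "\<dots> \<le> (2 powr p * w powr p) * F x / F x0"
        using pk pos[OF x] x0 by (intro divide_right_mono mult_right_mono) auto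
      also have "\<dots> = C * w powr p * F x" by (simp add: C_def)
      also have "\<dots> \<le> C * (1 + w powr p) * F x"
        using C pos[OF x] by (intro mult_right_mono mult_left_mono) auto
      finally show ?thesis .
    qed
  qed (use x0 pos in auto)
qed

section \<open>Campbell's formula\<close>

text \<open>The points are ordered and finitely many lie below \<open>t\<close>, so their indices
  form an initial segment. This identifies the sum over \<open>1..counting \<tau> t \<omega>\<close>
  as the sum over all points up to \<open>t\<close>.\<close>

lemma poisson_process_points:
  assumes "poisson_process M lam \<tau>" and \<omega>: "\<omega> \<in> space M"
  shows "{i. 1 \<le> i \<and> \<tau> i \<omega> \<le> ereal t} = {1..counting \<tau> t \<omega>}"
proof -
  define S where "S = {i. 1 \<le> i \<and> \<tau> i \<omega> \<le> ereal t}"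
  have fin: "finite S" and step: "\<And>i. 1 \<le> i \<Longrightarrow> \<tau> i \<omega> \<le> \<tau> (Suc i) \<omega>"
    using assms by (auto simp: poisson_process_def S_def)
  have mono: "\<tau> i \<omega> \<le> \<tau> j \<omega>" if "1 \<le> i" "i \<le> j" for i j
    using that(2) by (induction rule: dec_induct) (use that step in \<open>auto intro: order_trans\<close>)
  obtain n where "S = {1..n}"
  proof (cases "S = {}")
    case False
    have "\<tau> (Max S) \<omega> \<le> ereal t" using Max_in[OF fin False] by (simp add: S_def)
    then have "{1..Max S} \<subseteq> S" using order_trans[OF mono] by (auto simp: S_def)
    moreover have "S \<subseteq> {1..Max S}" using fin by (auto simp: S_def)
    ultimately show ?thesis using that by blast
  qed (use that[of 0] in auto)
  then show ?thesis by (simp add: S_def counting_def)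
qed

lemma poisson_process_le_counting_iff:
  assumes "poisson_process M lam \<tau>" "\<omega> \<in> space M" "1 \<le> i"
  shows "\<tau> i \<omega> \<le> ereal t \<longleftrightarrow> i \<le> counting \<tau> t \<omega>"
proof -
  have "i \<in> {i. 1 \<le> i \<and> \<tau> i \<omega> \<le> ereal t} \<longleftrightarrow> i \<in> {1..counting \<tau> t \<omega>}"
    by (simp only: poisson_process_points[OF assms(1,2)])
  with \<open>1 \<le> i\<close> show ?thesis by simp
qed

text \<open>
  Unlike the cardinality in \<open>counting\<close>, this form is measurable in an arbitrary sequence of points.
\<close>

lemma counting_eq_Least:
  assumes "poisson_process M lam \<tau>" "\<omega> \<in> space M"
  shows "counting \<tau> t \<omega> = (LEAST n. ereal t < \<tau> (Suc n) \<omega>)"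
  using poisson_process_le_counting_iff[OF assms, of "Suc _" t]
  by (intro Least_equality[symmetric]) (auto simp: not_le[symmetric])

lemma measurable_counting [measurable]:
  assumes "poisson_process M lam \<tau>"
  shows "counting \<tau> t \<in> measurable M (count_space UNIV)"
proof -
  have [measurable]: "\<tau> (Suc i) \<in> borel_measurable M" for i
    using assms by (auto simp: poisson_process_def)
  have "(\<lambda>\<omega>. LEAST n. ereal t < \<tau> (Suc n) \<omega>) \<in> measurable M (count_space UNIV)" by measurable
  then show ?thesis
    by (rule measurable_cong[THEN iffD1, rotated]) (simp add: counting_eq_Least[OF assms])
qed

lemma counting_mono:
  assumes "poisson_process M lam \<tau>" "\<omega> \<in> space M" "s \<le> t"
  shows "counting \<tau> s \<omega> \<le> counting \<tau> t \<omega>"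
proof (cases "counting \<tau> s \<omega> = 0")
  case False
  then have i: "1 \<le> counting \<tau> s \<omega>" by simp
  have "\<tau> (counting \<tau> s \<omega>) \<omega> \<le> ereal s"
    using poisson_process_le_counting_iff[OF assms(1,2) i] by simp
  also have "\<dots> \<le> ereal t" using \<open>s \<le> t\<close> by simp
  finally show ?thesis using poisson_process_le_counting_iff[OF assms(1,2) i] by simp
qed simp

section \<open>Generating functions of the increments\<close>

lemma nn_integral_nat_valued:
  assumes [measurable]: "J \<in> measurable M (count_space (UNIV :: nat set))"
  shows "(\<integral>\<^sup>+\<omega>. g (J \<omega>) \<partial>M) = (\<Sum>k. g k * emeasure M {\<omega>\<in>space M. J \<omega> = k})"
proof -
  have "(\<integral>\<^sup>+\<omega>. g (J \<omega>) \<partial>M) = (\<integral>\<^sup>+\<omega>. (\<Sum>k. g k * indicator {\<omega>\<in>space M. J \<omega> = k} \<omega>) \<partial>M)"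
  proof (rule nn_integral_cong)
    fix \<omega> assume "\<omega> \<in> space M"
    then show "g (J \<omega>) = (\<Sum>k. g k * indicator {\<omega>\<in>space M. J \<omega> = k} \<omega>)"
      by (subst suminf_cmult_indicator[of _ \<omega> "J \<omega>"]) (auto simp: disjoint_family_on_def)
  qed
  also have "\<dots> = (\<Sum>k. g k * emeasure M {\<omega>\<in>space M. J \<omega> = k})"
    by (subst nn_integral_suminf) (auto simp: nn_integral_cmult)
  finally show ?thesis .
qed

lemma poisson_process_intensity:
  assumes "poisson_process M lam \<tau>" "0 \<le> t"
  shows "0 \<le> lam t" "set_integrable lborel {0..t} lam"
  using assms unfolding poisson_process_def by blast+

lemma poisson_process_indep_increments:
  fixes t :: "nat \<Rightarrow> real"
  assumes "poisson_process M lam \<tau>" "0 \<le> t 0" "incseq t"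
  shows "prob_space.indep_vars M (\<lambda>_. count_space UNIV)
    (\<lambda>k \<omega>. counting \<tau> (t (Suc k)) \<omega> - counting \<tau> (t k) \<omega>) UNIV"
  using assms unfolding poisson_process_def by blast

lemma cumulative_intensity_0: "cumulative_intensity lam 0 = 0"
proof -
  have "AE s in lborel. indicator {0..0} s *\<^sub>R lam s = 0"
    using AE_lborel_singleton[of 0] by eventually_elim simp
  then show ?thesis
    unfolding cumulative_intensity_def set_lebesgue_integral_def by (rule integral_eq_zero_AE)
qed

lemma cumulative_intensity_mono:
  assumes "poisson_process M lam \<tau>" "0 \<le> s" "s \<le> t"
  shows "cumulative_intensity lam s \<le> cumulative_intensity lam t"
proof -
  note lam = poisson_process_intensity[OF assms(1)]
  show ?thesis
    unfolding cumulative_intensity_def set_lebesgue_integral_def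
    using lam(1) lam(2)[of s] lam(2)[of t] assms(2,3) by (intro integral_mono) (auto simp: set_integrable_def split: split_indicator)
qed

text \<open>The probability generating function of the Poisson law, and \<open>c\<close> times its
  derivative in \<open>c\<close>. The rate 0 is included.\<close>

lemma poisson_suminf:
  fixes \<mu> c :: real
  assumes "0 \<le> \<mu>" "0 \<le> c"
  shows "(\<Sum>k. ennreal (c ^ k) * ennreal (exp (- \<mu>) * \<mu> ^ k / fact k)) = ennreal (exp (\<mu> * (c - 1)))"
    and "(\<Sum>k. ennreal (c ^ k * real k) * ennreal (exp (- \<mu>) * \<mu> ^ k / fact k)) =
      ennreal (\<mu> * c * exp (\<mu> * (c - 1)))"
proof -
  have "(\<lambda>k. exp (- \<mu>) * ((c * \<mu>) ^ k / fact k)) sums (exp (- \<mu>) * exp (c * \<mu>))"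
    using exp_converges[of "c * \<mu>"] by (intro sums_mult) (simp add: divide_inverse mult.commute)
  moreover have "exp (- \<mu>) * exp (c * \<mu>) = exp (\<mu> * (c - 1))"
    by (simp add: algebra_simps flip: exp_add)
  moreover have "exp (- \<mu>) * ((c * \<mu>) ^ k / fact k) = c ^ k * (exp (- \<mu>) * \<mu> ^ k / fact k)" for k
    by (simp add: power_mult_distrib)
  ultimately have *: "(\<lambda>k. c ^ k * (exp (- \<mu>) * \<mu> ^ k / fact k)) sums exp (\<mu> * (c - 1))"
    by (simp only:)
  show "(\<Sum>k. ennreal (c ^ k) * ennreal (exp (- \<mu>) * \<mu> ^ k / fact k)) = ennreal (exp (\<mu> * (c - 1)))"
    using assms sums_unique[OF *] sums_summable[OF *]
    by (subst ennreal_mult[symmetric]) (auto simp: suminf_ennreal2)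
  \<comment> \<open>Shifting the index by one cancels \<open>real k\<close> against the factorial
    and reduces this series to the previous one; the term dropped, \<open>a 0\<close>, is 0.\<close>
  define a where "a k = c ^ k * real k * (exp (- \<mu>) * \<mu> ^ k / fact k)" for k
  have "a (Suc k) = \<mu> * c * (c ^ k * (exp (- \<mu>) * \<mu> ^ k / fact k))" for k
    by (simp add: a_def field_simps del: of_nat_Suc)
  then have "(\<lambda>k. a (Suc k)) sums (\<mu> * c * exp (\<mu> * (c - 1)))"
    using sums_mult[OF *, of "\<mu> * c"] by simp
  then have "a sums (\<mu> * c * exp (\<mu> * (c - 1)) + a 0)" by (rule sums_Suc)
  then have **: "a sums (\<mu> * c * exp (\<mu> * (c - 1)))" by (simp add: a_def)
  have "(\<Sum>k. ennreal (a k)) = ennreal (\<mu> * c * exp (\<mu> * (c - 1)))"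
    using assms sums_unique[OF **] sums_summable[OF **]
    by (subst suminf_ennreal2) (auto simp: a_def)
  then show "(\<Sum>k. ennreal (c ^ k * real k) * ennreal (exp (- \<mu>) * \<mu> ^ k / fact k)) =
      ennreal (\<mu> * c * exp (\<mu> * (c - 1)))"
    using assms by (subst ennreal_mult[symmetric]) (auto simp: a_def)
qed

lemma poisson_process_increment:
  assumes "prob_space M" and pp: "poisson_process M lam \<tau>" and st: "0 \<le> s" "s \<le> t" and "0 \<le> c"
  defines "\<mu> \<equiv> cumulative_intensity lam t - cumulative_intensity lam s"
  shows "(\<integral>\<^sup>+\<omega>. ennreal (c ^ (counting \<tau> t \<omega> - counting \<tau> s \<omega>)) \<partial>M) = ennreal (exp (\<mu> * (c - 1)))"
    and "(\<integral>\<^sup>+\<omega>. ennreal (c ^ (counting \<tau> t \<omega> - counting \<tau> s \<omega>) *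
      real (counting \<tau> t \<omega> - counting \<tau> s \<omega>)) \<partial>M) = ennreal (\<mu> * c * exp (\<mu> * (c - 1)))"
proof -
  interpret prob_space M by fact
  note [measurable] = measurable_counting[OF pp]
  have em: "emeasure M {\<omega>\<in>space M. counting \<tau> t \<omega> - counting \<tau> s \<omega> = k} =
      ennreal (exp (- \<mu>) * \<mu> ^ k / fact k)" for k
    using pp st unfolding emeasure_eq_measure by (auto simp: poisson_process_def \<mu>_def Let_def)
  have \<mu>: "0 \<le> \<mu>" using cumulative_intensity_mono[OF pp st] by (simp add: \<mu>_def)
  show "(\<integral>\<^sup>+\<omega>. ennreal (c ^ (counting \<tau> t \<omega> - counting \<tau> s \<omega>)) \<partial>M) = ennreal (exp (\<mu> * (c - 1)))"
    using \<mu> \<open>0 \<le> c\<close> poisson_suminf(1)[of \<mu> c]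
      nn_integral_nat_valued[of "\<lambda>\<omega>. counting \<tau> t \<omega> - counting \<tau> s \<omega>" M "\<lambda>k. ennreal (c ^ k)"]
    by (simp add: em)
  show "(\<integral>\<^sup>+\<omega>. ennreal (c ^ (counting \<tau> t \<omega> - counting \<tau> s \<omega>) *
      real (counting \<tau> t \<omega> - counting \<tau> s \<omega>)) \<partial>M) = ennreal (\<mu> * c * exp (\<mu> * (c - 1)))"
    using \<mu> \<open>0 \<le> c\<close> poisson_suminf(2)[of \<mu> c]
      nn_integral_nat_valued[of "\<lambda>\<omega>. counting \<tau> t \<omega> - counting \<tau> s \<omega>" M "\<lambda>k. ennreal (c ^ k * real k)"]
    by (simp add: em)
qed

text \<open>\<open>c ^ counting \<tau> T \<omega>\<close> splits into powers for the increments
  before and after \<open>a\<close>, which are independent. The two exponentials recombine to one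
  that is free of \<open>a\<close>, so the result is proportional to the intensity mass of the
  stretch from \<open>a\<close> to \<open>T\<close>.\<close>

lemma poisson_process_weighted_increment:
  assumes "prob_space M" and pp: "poisson_process M lam \<tau>" and aT: "0 \<le> a" "a \<le> T" and "0 \<le> c"
  shows "(\<integral>\<^sup>+\<omega>. ennreal (c ^ counting \<tau> T \<omega> * real (counting \<tau> T \<omega> - counting \<tau> a \<omega>)) \<partial>M) =
    ennreal (c * exp (cumulative_intensity lam T * (c - 1)) *
      (cumulative_intensity lam T - cumulative_intensity lam a))"
proof -
  let ?m = "cumulative_intensity lam"
  interpret prob_space M by fact
  note [measurable] = measurable_counting[OF pp]
  \<comment> \<open>Independence of increments is stated for infinite time sequences;
    \<open>0, a, T, T, ...\<close> embeds the two that matter as \<open>N 0\<close> and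
    \<open>N 1\<close>.\<close>
  define t where "t k = (if k = 0 then 0 else if k = 1 then a else T)" for k :: nat
  define N where "N k \<omega> = counting \<tau> (t (Suc k)) \<omega> - counting \<tau> (t k) \<omega>" for k \<omega>
  have t: "t 0 = 0" "t (Suc 0) = a" "t (Suc (Suc 0)) = T" by (auto simp: t_def)
  have "incseq t" using aT by (auto simp: t_def incseq_def)
  then have "indep_vars (\<lambda>_. count_space UNIV) N UNIV"
    using poisson_process_indep_increments[OF pp, of t] unfolding N_def[abs_def] by (simp add: t)
  then have "indep_vars (\<lambda>_. count_space UNIV) N {0, 1}" by (rule indep_vars_subset) simp
  then have ind: "indep_vars (\<lambda>_. borel)
      (\<lambda>i. (\<lambda>k. ennreal (c ^ k * (if i = 0 then 1 else real k))) \<circ> N i) {0, 1}"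
    by (rule indep_vars_compose) simp
  have 0: "AE \<omega> in M. counting \<tau> 0 \<omega> = 0" using pp by (simp add: poisson_process_def)
  have "(\<integral>\<^sup>+\<omega>. ennreal (c ^ counting \<tau> T \<omega> * real (counting \<tau> T \<omega> - counting \<tau> a \<omega>)) \<partial>M) =
      (\<integral>\<^sup>+\<omega>. (\<Prod>i\<in>{0, 1}. ((\<lambda>k. ennreal (c ^ k * (if i = 0 then 1 else real k))) \<circ> N i) \<omega>) \<partial>M)"
  proof (rule nn_integral_cong_AE)
    show "AE \<omega> in M. ennreal (c ^ counting \<tau> T \<omega> * real (counting \<tau> T \<omega> - counting \<tau> a \<omega>)) =
        (\<Prod>i\<in>{0, 1}. ((\<lambda>k. ennreal (c ^ k * (if i = 0 then 1 else real k))) \<circ> N i) \<omega>)"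
      using 0 AE_space
    proof eventually_elim
      case (elim \<omega>)
      have "N 0 \<omega> = counting \<tau> a \<omega>" "N 1 \<omega> = counting \<tau> T \<omega> - counting \<tau> a \<omega>"
        "counting \<tau> a \<omega> \<le> counting \<tau> T \<omega>"
        using elim counting_mono[OF pp _ aT(2)] by (auto simp: N_def t)
      moreover from this have "c ^ counting \<tau> T \<omega> = c ^ N 0 \<omega> * c ^ N 1 \<omega>"
        by (simp flip: power_add)
      ultimately show ?case
        using \<open>0 \<le> c\<close> by (simp add: mult.assoc flip: ennreal_mult)
    qed
  qed
  also have "\<dots> = (\<Prod>i\<in>{0, 1}. \<integral>\<^sup>+\<omega>. ((\<lambda>k. ennreal (c ^ k * (if i = 0 then 1 else real k))) \<circ> N i) \<omega> \<partial>M)"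
    by (rule indep_vars_nn_integral[OF _ ind]) auto
  also have "\<dots> = ennreal (exp ((cumulative_intensity lam a - cumulative_intensity lam 0) * (c - 1))) *
    ennreal ((cumulative_intensity lam T - cumulative_intensity lam a) * c *
      exp ((cumulative_intensity lam T - cumulative_intensity lam a) * (c - 1)))"
    using poisson_process_increment(1)[OF \<open>prob_space M\<close> pp _ aT(1) \<open>0 \<le> c\<close>]
      poisson_process_increment(2)[OF \<open>prob_space M\<close> pp aT \<open>0 \<le> c\<close>]
    by (simp add: N_def t)
  also have "\<dots> = ennreal (exp (?m a * (c - 1)) * ((?m T - ?m a) * c * exp ((?m T - ?m a) * (c - 1))))"
    using cumulative_intensity_mono[OF pp aT] \<open>0 \<le> c\<close>
    by (subst ennreal_mult) (auto simp: cumulative_intensity_0)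
  also have "exp (?m a * (c - 1)) * ((?m T - ?m a) * c * exp ((?m T - ?m a) * (c - 1))) =
      c * (exp (?m a * (c - 1)) * exp ((?m T - ?m a) * (c - 1))) * (?m T - ?m a)"
    by simp
  also have "exp (?m a * (c - 1)) * exp ((?m T - ?m a) * (c - 1)) = exp (?m T * (c - 1))"
    by (simp add: algebra_simps flip: exp_add)
  finally show ?thesis .
qed

text \<open>Weighting the law by \<open>c ^ N\<close> amounts to multiplying the intensity on
  \<open>{0..T}\<close> by \<open>c\<close>, up to the mean \<open>exp (m * (c - 1))\<close> of the
  weight, where \<open>m = cumulative_intensity lam T\<close>; hence the constant. For
  \<open>g\<close> the indicator of a half-line the left side is a weighted count of the points
  beyond a level, which is \<open>poisson_process_weighted_increment\<close>.\<close>

proposition poisson_process_campbell: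
  fixes g :: "real \<Rightarrow> ennreal"
  assumes "prob_space M" and pp: "poisson_process M lam \<tau>" and "0 \<le> T" "0 \<le> c"
    and g: "g \<in> borel_measurable borel"
  shows "(\<integral>\<^sup>+\<omega>. (\<Sum>i=1..counting \<tau> T \<omega>. ennreal (c ^ counting \<tau> T \<omega>) * g (real_of_ereal (\<tau> i \<omega>))) \<partial>M) =
    ennreal (c * exp (cumulative_intensity lam T * (c - 1))) *
      (\<integral>\<^sup>+s. ennreal (indicator {0..T} s * lam s) * g s \<partial>lborel)"
proof -
  interpret prob_space M by fact
  interpret P: pair_sigma_finite "count_space (UNIV :: nat set)" M
    by (intro pair_sigma_finite.intro sigma_finite_measure_count_space sigma_finite_measure_axioms)
  note [measurable] = measurable_counting[OF pp]
  define N where "N = counting \<tau> T"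
  define m where "m = cumulative_intensity lam"
  define C where "C = c * exp (m T * (c - 1))"
  have C: "0 \<le> C" using \<open>0 \<le> c\<close> by (simp add: C_def)
  have \<tau>: "\<tau> (Suc i) \<in> borel_measurable M" for i
    using pp unfolding poisson_process_def by auto
  have [measurable]: "N \<in> measurable M (count_space UNIV)" unfolding N_def by measurable
  \<comment> \<open>The sum over the points becomes an integral over index and outcome, with the
    random range hidden in the weight, so that Tonelli and image measures apply. Points are numbered
    from 1, hence \<open>Suc i\<close> in \<open>r\<close>.\<close>
  define w where "w = (\<lambda>(i, \<omega>). ennreal (c ^ N \<omega>) * (if i < N \<omega> then 1 else 0))"
  define r where "r = (\<lambda>(i, \<omega>). real_of_ereal (\<tau> (Suc i) \<omega>))"
  define P where "P = count_space (UNIV :: nat set) \<Otimes>\<^sub>M M"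
  have [measurable]: "w \<in> borel_measurable P" unfolding P_def
    by (rule measurable_pair_measure_countable1) (auto simp: w_def)
  have [measurable]: "r \<in> borel_measurable P" unfolding P_def
    by (rule measurable_pair_measure_countable1) (auto simp: r_def intro: borel_measurable_real_of_ereal \<tau>)
  \<comment> \<open>both sides are integrals of \<open>g\<close>, over \<open>\<nu>\<close> and \<open>\<rho>\<close>, which agree on the half-lines \<open>{x<..}\<close>\<close>
  define \<nu> where "\<nu> = distr (density P w) borel r"
  have \<nu>: "(\<integral>\<^sup>+s. f s \<partial>\<nu>) = (\<integral>\<^sup>+\<omega>. (\<Sum>i<N \<omega>. ennreal (c ^ N \<omega>) * f (real_of_ereal (\<tau> (Suc i) \<omega>))) \<partial>M)"
    if [measurable]: "f \<in> borel_measurable borel" for f :: "real \<Rightarrow> ennreal"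
  proof -
    have "(\<integral>\<^sup>+s. f s \<partial>\<nu>) = (\<integral>\<^sup>+z. w z * f (r z) \<partial>P)"
      by (simp add: \<nu>_def nn_integral_distr nn_integral_density)
    also have "\<dots> = (\<integral>\<^sup>+\<omega>. \<integral>\<^sup>+i. w (i, \<omega>) * f (r (i, \<omega>)) \<partial>count_space UNIV \<partial>M)"
      unfolding P_def by (intro P.nn_integral_snd[symmetric]) (simp flip: P_def)
    also have "\<dots> = (\<integral>\<^sup>+\<omega>. (\<Sum>i<N \<omega>. ennreal (c ^ N \<omega>) * f (real_of_ereal (\<tau> (Suc i) \<omega>))) \<partial>M)"
    proof (rule nn_integral_cong)
      fix \<omega>
      have "(\<integral>\<^sup>+i. w (i, \<omega>) * f (r (i, \<omega>)) \<partial>count_space UNIV) = (\<Sum>i. w (i, \<omega>) * f (r (i, \<omega>)))"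
        by (rule nn_integral_count_space_nat)
      also have "\<dots> = (\<Sum>i<N \<omega>. w (i, \<omega>) * f (r (i, \<omega>)))"
        by (rule suminf_finite) (auto simp: w_def)
      also have "\<dots> = (\<Sum>i<N \<omega>. ennreal (c ^ N \<omega>) * f (real_of_ereal (\<tau> (Suc i) \<omega>)))"
        by (rule sum.cong) (auto simp: w_def r_def)
      finally show "(\<integral>\<^sup>+i. w (i, \<omega>) * f (r (i, \<omega>)) \<partial>count_space UNIV) =
          (\<Sum>i<N \<omega>. ennreal (c ^ N \<omega>) * f (real_of_ereal (\<tau> (Suc i) \<omega>)))" .
    qed
    finally show ?thesis .
  qed
  note lam = poisson_process_intensity[OF pp]
  have int: "integrable lborel (\<lambda>s. indicator {0..b} s * lam s)" if "0 \<le> b" for b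
    using lam(2)[OF that] by (simp add: set_integrable_def)
  have [measurable]: "(\<lambda>s. indicator {0..T} s * lam s) \<in> borel_measurable borel"
    using int[OF \<open>0 \<le> T\<close>] by auto
  have m_eq: "m b = (\<integral>s. indicator {0..b} s * lam s \<partial>lborel)" for b
    by (simp add: m_def cumulative_intensity_def set_lebesgue_integral_def)
  define \<rho> where "\<rho> = density lborel (\<lambda>s. ennreal (C * (indicator {0..T} s * lam s)))"
  \<comment> \<open>Clamping \<open>x\<close> to \<open>{0..T}\<close> makes one formula serve all
    half-lines: below 0 every point counts, almost surely none lying at 0, and from \<open>T\<close>
    on none does.\<close>
  define a where "a x = min T (max 0 x)" for x
  have a: "0 \<le> a x" "a x \<le> T" for x using \<open>0 \<le> T\<close> by (auto simp: a_def)
  have em_\<nu>: "emeasure \<nu> {x<..} = ennreal (C * (m T - m (a x)))" for x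
  proof -
    have "emeasure \<nu> {x<..} = (\<integral>\<^sup>+s. indicator {x<..} s \<partial>\<nu>)" by (simp add: \<nu>_def)
    also have "\<dots> = (\<integral>\<^sup>+\<omega>. (\<Sum>i<N \<omega>. ennreal (c ^ N \<omega>) * indicator {x<..} (real_of_ereal (\<tau> (Suc i) \<omega>))) \<partial>M)"
      by (rule \<nu>) simp
    also have "\<dots> = (\<integral>\<^sup>+\<omega>. ennreal (c ^ N \<omega> * real (N \<omega> - counting \<tau> (a x) \<omega>)) \<partial>M)"
    proof (rule nn_integral_cong_AE)
      have "AE \<omega> in M. counting \<tau> 0 \<omega> = 0" using pp by (simp add: poisson_process_def)
      then show "AE \<omega> in M. (\<Sum>i<N \<omega>. ennreal (c ^ N \<omega>) * indicator {x<..} (real_of_ereal (\<tau> (Suc i) \<omega>))) =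
          ennreal (c ^ N \<omega> * real (N \<omega> - counting \<tau> (a x) \<omega>))"
        using AE_space
      proof eventually_elim
        case (elim \<omega>)
        note iff = poisson_process_le_counting_iff[OF pp elim(2)]
        have nonneg: "0 \<le> \<tau> (Suc i) \<omega>" for i
          using pp elim(2) unfolding poisson_process_def by auto
        have "x < real_of_ereal (\<tau> (Suc i) \<omega>) \<longleftrightarrow> counting \<tau> (a x) \<omega> \<le> i" if "i < N \<omega>" for i
        proof -
          \<comment> \<open>Only points up to \<open>T\<close> enter, so they are finite and
            \<open>real_of_ereal\<close> returns the true value.\<close>
          have "\<tau> (Suc i) \<omega> \<le> ereal T" using that iff[of "Suc i" T] by (simp add: N_def)
          with nonneg[of i] obtain s where s: "\<tau> (Suc i) \<omega> = ereal s" "0 \<le> s" "s \<le> T"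
            by (cases "\<tau> (Suc i) \<omega>") auto
          have gt: "b < s \<longleftrightarrow> counting \<tau> b \<omega> \<le> i" for b
            using iff[of "Suc i" b] s by auto
          show ?thesis
          proof (cases "x < 0")
            case True
            then show ?thesis using s elim(1) \<open>0 \<le> T\<close> by (simp add: a_def)
          next
            case False
            have "x < s \<longleftrightarrow> a x < s" if "s \<noteq> T \<or> x < T"
              using s False that by (auto simp: a_def)
            moreover have ?thesis if "s = T" "T \<le> x"
              using gt[of T] s that \<open>0 \<le> T\<close> by (simp add: a_def)
            ultimately show ?thesis using gt[of "a x"] s by fastforce
          qed
        qed
        then have "(\<Sum>i<N \<omega>. ennreal (c ^ N \<omega>) * indicator {x<..} (real_of_ereal (\<tau> (Suc i) \<omega>))) =
            (\<Sum>i<N \<omega>. if counting \<tau> (a x) \<omega> \<le> i then ennreal (c ^ N \<omega>) else 0)"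
          by (intro sum.cong) (auto simp: indicator_def)
        also have "\<dots> = (\<Sum>i\<in>{counting \<tau> (a x) \<omega>..<N \<omega>}. ennreal (c ^ N \<omega>))"
          by (intro sum.mono_neutral_cong_right) auto
        also have "\<dots> = ennreal (c ^ N \<omega> * real (N \<omega> - counting \<tau> (a x) \<omega>))"
          using \<open>0 \<le> c\<close> by (simp add: ennreal_mult mult.commute ennreal_of_nat_eq_real_of_nat)
        finally show ?case .
      qed
    qed
    also have "\<dots> = ennreal (C * (m T - m (a x)))"
      unfolding N_def C_def m_def
      by (rule poisson_process_weighted_increment[OF \<open>prob_space M\<close> pp a \<open>0 \<le> c\<close>])
    finally show ?thesis .
  qed
  have em_\<rho>: "emeasure \<rho> {x<..} = ennreal (C * (m T - m (a x)))" for x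
  proof -
    have "emeasure \<rho> {x<..} = (\<integral>\<^sup>+s. ennreal (C * (indicator {0..T} s * lam s)) * indicator {x<..} s \<partial>lborel)"
      unfolding \<rho>_def by (rule emeasure_density) auto
    also have "\<dots> = (\<integral>\<^sup>+s. ennreal (C * (indicator {0..T} s * lam s - indicator {0..a x} s * lam s)) \<partial>lborel)"
    proof (rule nn_integral_cong_AE)
      \<comment> \<open>For \<open>x < 0\<close> the subtracted interval is the single point 0,
        where the integrands may differ; it is a null set.\<close>
      show "AE s in lborel. ennreal (C * (indicator {0..T} s * lam s)) * indicator {x<..} s =
          ennreal (C * (indicator {0..T} s * lam s - indicator {0..a x} s * lam s))"
        using AE_lborel_singleton[of 0]
        by eventually_elim (auto simp: a_def min_def max_def split: split_indicator if_splits)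
    qed
    also have "\<dots> = ennreal (\<integral>s. C * (indicator {0..T} s * lam s - indicator {0..a x} s * lam s) \<partial>lborel)"
      using C lam(1) int \<open>0 \<le> T\<close> a[of x]
      by (intro nn_integral_eq_integral) (auto split: split_indicator)
    also have "\<dots> = ennreal (C * (m T - m (a x)))"
      using int \<open>0 \<le> T\<close> a by (simp add: m_eq)
    finally show ?thesis .
  qed
  have "\<nu> = \<rho>"
    by (rule measure_eqI_lessThan) (auto simp: em_\<nu> em_\<rho>, auto simp: \<nu>_def \<rho>_def)
  have "(\<integral>\<^sup>+\<omega>. (\<Sum>i=1..N \<omega>. ennreal (c ^ N \<omega>) * g (real_of_ereal (\<tau> i \<omega>))) \<partial>M) = (\<integral>\<^sup>+s. g s \<partial>\<nu>)"
    by (simp add: \<nu>[OF g] sum.atLeast1_atMost_eq)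
  also have "\<dots> = (\<integral>\<^sup>+s. ennreal C * (ennreal (indicator {0..T} s * lam s) * g s) \<partial>lborel)"
    unfolding \<open>\<nu> = \<rho>\<close> \<rho>_def using g C lam(1)
    by (subst nn_integral_density)
      (auto simp: ennreal_mult mult.assoc intro!: nn_integral_cong split: split_indicator)
  also have "\<dots> = ennreal C * (\<integral>\<^sup>+s. ennreal (indicator {0..T} s * lam s) * g s \<partial>lborel)"
    using g by (intro nn_integral_cmult) auto
  finally show ?thesis by (simp add: C_def N_def m_def)
qed

section \<open>Shot noise\<close>

text \<open>Some term exceeds \<open>x / n\<close>, so shock \<open>i\<close> exceeds
  \<open>x / (n * w i)\<close>, and the scaling bound is applied with \<open>n * w i\<close>. The
  factor \<open>n powr p\<close> is at most \<open>exp p ^ n\<close> because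
  \<open>n \<le> exp n\<close>. A weight 0 is treated apart, as the scaling bound asks for a
  positive scale.\<close>

lemma tail_weighted_sum_bound:
  fixes F :: "real \<Rightarrow> real" and w :: "nat \<Rightarrow> real"
  assumes "prob_space M" and X: "\<And>i. i \<in> {1..n} \<Longrightarrow> X i \<in> borel_measurable M"
    and F: "\<And>i x. i \<in> {1..n} \<Longrightarrow> tail M (X i) x = F x"
    and w: "\<And>i. i \<in> {1..n} \<Longrightarrow> 0 \<le> w i"
    and C: "0 \<le> C" "\<And>w. 0 < w \<Longrightarrow> F (x / w) \<le> C * (1 + w powr p) * F x"
    and "0 < x" "0 \<le> F x" "0 \<le> p"
  shows "tail M (\<lambda>\<omega>. \<Sum>i=1..n. w i * X i \<omega>) x \<le> C * (\<Sum>i=1..n. exp p ^ n * (1 + w i powr p)) * F x"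
proof -
  interpret prob_space M by fact
  define A where "A i = {\<omega>\<in>space M. w i * X i \<omega> > x / n}" for i
  have A [measurable]: "A i \<in> events" if "i \<in> {1..n}" for i
    using X[OF that] unfolding A_def by measurable
  have "{\<omega>\<in>space M. x < (\<Sum>i=1..n. w i * X i \<omega>)} \<subseteq> (\<Union>i\<in>{1..n}. A i)"
  proof (rule subsetI, rule ccontr)
    fix \<omega> assume \<omega>: "\<omega> \<in> {\<omega>\<in>space M. x < (\<Sum>i=1..n. w i * X i \<omega>)}" "\<omega> \<notin> (\<Union>i\<in>{1..n}. A i)"
    then have "(\<Sum>i=1..n. w i * X i \<omega>) \<le> real (card {1..n}) * (x / n)"
      by (intro sum_bounded_above) (auto simp: A_def not_less)
    with \<omega> \<open>0 < x\<close> show False by (cases "n = 0") auto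
  qed
  then have "tail M (\<lambda>\<omega>. \<Sum>i=1..n. w i * X i \<omega>) x \<le> prob (\<Union>i\<in>{1..n}. A i)"
    unfolding tail_def by (intro finite_measure_mono) auto
  also have "\<dots> \<le> (\<Sum>i=1..n. prob (A i))"
    by (intro finite_measure_subadditive_finite) auto
  also have "\<dots> \<le> (\<Sum>i=1..n. C * (exp p ^ n * (1 + w i powr p)) * F x)"
  proof (rule sum_mono)
    fix i assume i: "i \<in> {1..n}"
    then have n: "1 \<le> real n" by simp
    show "prob (A i) \<le> C * (exp p ^ n * (1 + w i powr p)) * F x"
    proof (cases "w i = 0")
      case True
      then have "A i = {}" using \<open>0 < x\<close> n by (auto simp: A_def field_simps)
      then show ?thesis using C \<open>0 \<le> F x\<close> by simp
    next
      case False
      then have wi: "0 < w i" using w[OF i] by simp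
      have "A i = {\<omega>\<in>space M. X i \<omega> > x / (n * w i)}" using wi n by (auto simp: A_def field_simps)
      then have "prob (A i) = F (x / (n * w i))" using F[OF i] by (simp add: tail_def)
      also have "\<dots> \<le> C * (1 + (n * w i) powr p) * F x" using wi n by (intro C) simp
      also have "\<dots> \<le> C * (exp p ^ n * (1 + w i powr p)) * F x"
      proof -
        have "real n \<le> exp (real n)" using exp_ge_add_one_self[of "real n"] by linarith
        then have "real n powr p \<le> exp (real n) powr p" using \<open>0 \<le> p\<close> by (intro powr_mono2) auto
        also have "\<dots> = exp p ^ n" by (simp add: powr_def exp_of_nat_mult[symmetric] mult.commute)
        finally have "(n * w i) powr p \<le> exp p ^ n * w i powr p"
          using wi by (simp add: powr_mult mult_right_mono)
        moreover have "1 \<le> exp p ^ n" using \<open>0 \<le> p\<close> by (intro one_le_power) simp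
        ultimately have "1 + (n * w i) powr p \<le> exp p ^ n * (1 + w i powr p)"
          by (simp add: distrib_left add_mono)
        then show ?thesis using C \<open>0 \<le> F x\<close> by (intro mult_right_mono mult_left_mono)
      qed
      finally show ?thesis .
    qed
  qed
  also have "\<dots> = C * (\<Sum>i=1..n. exp p ^ n * (1 + w i powr p)) * F x"
    by (simp add: sum_distrib_left sum_distrib_right)
  finally show ?thesis .
qed

section \<open>Measurability of sums over the random number of points, and marks on the
  points\<close>

lemma random_sequence_nth: "1 \<le> i \<Longrightarrow> random_sequence Z \<omega> i = Z i \<omega>"
  by (simp add: random_sequence_def)

lemma measurable_Least_sequence [measurable]:
  "(\<lambda>s. LEAST n. ereal T < s (Suc n)) \<in> measurable (Pi\<^sub>M {1..} (\<lambda>_. borel)) (count_space (UNIV :: nat set))"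
proof -
  have [measurable]: "(\<lambda>s. s (Suc n)) \<in> borel_measurable (Pi\<^sub>M {1..} (\<lambda>_. borel :: ereal measure))" for n
    by (rule measurable_component_singleton) simp
  show ?thesis by measurable
qed

lemma borel_measurable_sum_random_length:
  fixes f :: "nat \<Rightarrow> 'a \<Rightarrow> nat \<Rightarrow> 'b :: {second_countable_topology, topological_comm_monoid_add}"
  assumes n: "n \<in> measurable M (count_space (UNIV :: nat set))"
    and f: "\<And>k i. 1 \<le> i \<Longrightarrow> (\<lambda>x. f k x i) \<in> borel_measurable M"
  shows "(\<lambda>x. \<Sum>i=1..n x. f (n x) x i) \<in> borel_measurable M"
  by (rule measurable_compose_countable[where f = "\<lambda>k x. \<Sum>i=1..k. f k x i", OF _ n])
    (auto intro!: borel_measurable_sum f)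

lemma measurable_eval_compose:
  assumes ev: "(\<lambda>(g, s). g s) \<in> borel_measurable (L \<Otimes>\<^sub>M borel)"
    and "g \<in> measurable Q L" "s \<in> borel_measurable Q" and \<phi>: "\<phi> \<in> measurable borel B"
  shows "(\<lambda>x. \<phi> (g x (s x))) \<in> measurable Q B"
  using measurable_compose[OF measurable_compose[OF measurable_Pair[OF assms(2,3)] ev] \<phi>] by simp

text \<open>With the points frozen, linearity reduces the expectation to the marginal laws of the
  \<open>H i\<close>, which coincide. Each mark is thus replaced by its mean \<open>G\<close> at the
  point, and the unmarked formula applies to \<open>G\<close>.\<close>

proposition marked_poisson_process_campbell:
  fixes \<phi> :: "real \<Rightarrow> ennreal" and H :: "nat \<Rightarrow> 'w \<Rightarrow> real \<Rightarrow> real"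
  assumes "prob_space M" and pp: "poisson_process M lam \<tau>" and "0 \<le> T" "0 \<le> c"
    and ev: "(\<lambda>(g, s). g s) \<in> borel_measurable (L \<Otimes>\<^sub>M borel)"
    and H: "iid M L H"
    and ind: "indep_elements M (Pi\<^sub>M {1..} (\<lambda>_. L)) (random_sequence H)
         (Pi\<^sub>M {1..} (\<lambda>_. borel)) (random_sequence \<tau>)"
    and \<phi> [measurable]: "\<phi> \<in> borel_measurable borel"
  shows "(\<integral>\<^sup>+\<omega>. (\<Sum>i=1..counting \<tau> T \<omega>. ennreal (c ^ counting \<tau> T \<omega>) *
        \<phi> (H i \<omega> (real_of_ereal (\<tau> i \<omega>)))) \<partial>M) =
    ennreal (c * exp (cumulative_intensity lam T * (c - 1))) *
      (\<integral>\<^sup>+s. ennreal (indicator {0..T} s * lam s) * (\<integral>\<^sup>+\<omega>. \<phi> (H 1 \<omega> s) \<partial>M) \<partial>lborel)"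
proof -
  interpret prob_space M by fact
  define N where "N s = (LEAST n. ereal T < s (Suc n))" for s :: "nat \<Rightarrow> ereal"
  have N: "counting \<tau> T \<omega> = N (random_sequence \<tau> \<omega>)" if "\<omega> \<in> space M" for \<omega>
    by (simp add: counting_eq_Least[OF pp that] N_def random_sequence_nth)
  have Hm: "H i \<in> measurable M L" if "1 \<le> i" for i
    using H that by (auto simp: iid_def indep_vars_def)
  define G where "G s = (\<integral>\<^sup>+\<omega>. \<phi> (H 1 \<omega> s) \<partial>M)" for s
  have "(\<lambda>(s, \<omega>). \<phi> (H 1 \<omega> s)) \<in> borel_measurable (borel \<Otimes>\<^sub>M M)"
    unfolding split_beta'
    by (rule measurable_eval_compose[OF ev measurable_compose[OF measurable_snd Hm] measurable_fst \<phi>]) simp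
  then have G: "G \<in> borel_measurable borel"
    unfolding G_def by (intro borel_measurable_nn_integral) simp
  have G_i: "(\<integral>\<^sup>+\<omega>. \<phi> (H i \<omega> s) \<partial>M) = G s" if i: "1 \<le> i" for i s
  proof -
    have m: "(\<lambda>g. \<phi> (g s)) \<in> borel_measurable L"
      by (rule measurable_eval_compose[OF ev measurable_ident measurable_const \<phi>, simplified])
    have "(\<integral>\<^sup>+\<omega>. \<phi> (H i \<omega> s) \<partial>M) = (\<integral>\<^sup>+g. \<phi> (g s) \<partial>distr M L (H i))"
      if "1 \<le> i" for i
      by (rule nn_integral_distr[OF Hm[OF that], symmetric]) (simp add: m)
    moreover have "distr M L (H i) = distr M L (H 1)" using H i unfolding iid_def by blast
    ultimately show ?thesis using i by (simp add: G_def)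
  qed
  \<comment> \<open>A functional of the two sequences alone: \<open>N\<close> recovers the number of
    points from \<open>s\<close>, so that the independence of the sequences can be used.\<close>
  define f where "f = (\<lambda>(y :: nat \<Rightarrow> real \<Rightarrow> real, s).
    \<Sum>i=1..N s. ennreal (c ^ N s) * \<phi> (y i (real_of_ereal (s i))))"
  have comp1: "(\<lambda>z. fst z i) \<in> measurable (Pi\<^sub>M {1..} (\<lambda>_. L) \<Otimes>\<^sub>M Pi\<^sub>M {1..} (\<lambda>_. borel :: ereal measure)) L"
    and comp2: "(\<lambda>z. snd z i) \<in> borel_measurable (Pi\<^sub>M {1..} (\<lambda>_. L) \<Otimes>\<^sub>M Pi\<^sub>M {1..} (\<lambda>_. borel :: ereal measure))"
    if "1 \<le> i" for i :: nat
    using that by (auto intro!: measurable_compose[OF measurable_fst] measurable_compose[OF measurable_snd]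
        measurable_component_singleton)
  have f: "f \<in> borel_measurable (Pi\<^sub>M {1..} (\<lambda>_. L) \<Otimes>\<^sub>M Pi\<^sub>M {1..} (\<lambda>_. borel))"
    unfolding f_def split_beta'
  proof (rule borel_measurable_sum_random_length[where
        f = "\<lambda>k z i. ennreal (c ^ k) * \<phi> (fst z i (real_of_ereal (snd z i)))"])
    show "(\<lambda>z. N (snd z)) \<in> measurable (Pi\<^sub>M {1..} (\<lambda>_. L) \<Otimes>\<^sub>M Pi\<^sub>M {1..} (\<lambda>_. borel)) (count_space UNIV)"
      unfolding N_def by (rule measurable_compose[OF measurable_snd measurable_Least_sequence])
    show "(\<lambda>z. ennreal (c ^ k) * \<phi> (fst z i (real_of_ereal (snd z i)))) \<in>
        borel_measurable (Pi\<^sub>M {1..} (\<lambda>_. L) \<Otimes>\<^sub>M Pi\<^sub>M {1..} (\<lambda>_. borel))" if "1 \<le> i" for k i :: nat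
      by (intro borel_measurable_times_ennreal measurable_const
          measurable_eval_compose[OF ev comp1[OF that] borel_measurable_real_of_ereal[OF comp2[OF that]] \<phi>]) simp
  qed
  have "(\<integral>\<^sup>+\<omega>. (\<Sum>i=1..counting \<tau> T \<omega>. ennreal (c ^ counting \<tau> T \<omega>) *
        \<phi> (H i \<omega> (real_of_ereal (\<tau> i \<omega>)))) \<partial>M) =
      (\<integral>\<^sup>+\<omega>. f (random_sequence H \<omega>, random_sequence \<tau> \<omega>) \<partial>M)"
    by (intro nn_integral_cong) (simp add: f_def N random_sequence_nth)
  also have "\<dots> = (\<integral>\<^sup>+\<omega>'. \<integral>\<^sup>+\<omega>. f (random_sequence H \<omega>, random_sequence \<tau> \<omega>') \<partial>M \<partial>M)"
    by (rule indep_elements_nn_integral[OF \<open>prob_space M\<close> ind f])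
  also have "\<dots> = (\<integral>\<^sup>+\<omega>'. (\<Sum>i=1..counting \<tau> T \<omega>'. ennreal (c ^ counting \<tau> T \<omega>') *
      G (real_of_ereal (\<tau> i \<omega>'))) \<partial>M)"
  proof (rule nn_integral_cong)
    fix \<omega>' assume "\<omega>' \<in> space M"
    then have "(\<integral>\<^sup>+\<omega>. f (random_sequence H \<omega>, random_sequence \<tau> \<omega>') \<partial>M) =
        (\<integral>\<^sup>+\<omega>. (\<Sum>i=1..counting \<tau> T \<omega>'. ennreal (c ^ counting \<tau> T \<omega>') *
          \<phi> (H i \<omega> (real_of_ereal (\<tau> i \<omega>')))) \<partial>M)"
      by (intro nn_integral_cong) (simp add: f_def N random_sequence_nth)
    also have "\<dots> = (\<Sum>i=1..counting \<tau> T \<omega>'. \<integral>\<^sup>+\<omega>. ennreal (c ^ counting \<tau> T \<omega>') *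
          \<phi> (H i \<omega> (real_of_ereal (\<tau> i \<omega>'))) \<partial>M)"
      by (intro nn_integral_sum borel_measurable_times_ennreal measurable_const
          measurable_eval_compose[OF ev Hm measurable_const \<phi>]) auto
    also have "\<dots> = (\<Sum>i=1..counting \<tau> T \<omega>'. ennreal (c ^ counting \<tau> T \<omega>') *
          G (real_of_ereal (\<tau> i \<omega>')))"
    proof (rule sum.cong[OF refl])
      fix i assume "i \<in> {1..counting \<tau> T \<omega>'}"
      then have i: "1 \<le> i" by simp
      show "(\<integral>\<^sup>+\<omega>. ennreal (c ^ counting \<tau> T \<omega>') * \<phi> (H i \<omega> (real_of_ereal (\<tau> i \<omega>'))) \<partial>M) =
          ennreal (c ^ counting \<tau> T \<omega>') * G (real_of_ereal (\<tau> i \<omega>'))"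
        unfolding G_i[OF i, symmetric]
        by (intro nn_integral_cmult measurable_eval_compose[OF ev Hm[OF i] measurable_const \<phi>]) simp
    qed
    finally show "(\<integral>\<^sup>+\<omega>. f (random_sequence H \<omega>, random_sequence \<tau> \<omega>') \<partial>M) =
        (\<Sum>i=1..counting \<tau> T \<omega>'. ennreal (c ^ counting \<tau> T \<omega>') * G (real_of_ereal (\<tau> i \<omega>')))" .
  qed
  also have "\<dots> = ennreal (c * exp (cumulative_intensity lam T * (c - 1))) *
      (\<integral>\<^sup>+s. ennreal (indicator {0..T} s * lam s) * G s \<partial>lborel)"
    by (rule poisson_process_campbell[OF \<open>prob_space M\<close> pp \<open>0 \<le> T\<close> \<open>0 \<le> c\<close> G])
  finally show ?thesis by (simp add: G_def)
qed

text \<open>Decoupling: \<open>\<omega>'\<close> carries shock functions and instants,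
  \<open>\<omega>\<close> the shocks. By independence the tail of the shot noise is the mean of the
  tails of sums with frozen weights, to which the results on deterministic weights apply.\<close>

lemma
  fixes X :: "nat \<Rightarrow> 'w \<Rightarrow> real" and h :: "nat \<Rightarrow> 'w \<Rightarrow> real \<Rightarrow> real \<Rightarrow> real"
  assumes model: "shot_noise_model M K lam X h \<tau>"
  shows measurable_shot_noise: "shot_noise X h \<tau> T \<in> borel_measurable M"
    and measurable_decoupled_tail: "(\<lambda>\<omega>'. tail M (\<lambda>\<omega>. \<Sum>i=1..counting \<tau> T \<omega>'.
      h i \<omega>' T (real_of_ereal (\<tau> i \<omega>')) * X i \<omega>) x) \<in> borel_measurable M"
    and tail_shot_noise: "tail M (shot_noise X h \<tau> T) x = (\<integral>\<omega>'. tail M (\<lambda>\<omega>. \<Sum>i=1..counting \<tau> T \<omega>'.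
      h i \<omega>' T (real_of_ereal (\<tau> i \<omega>')) * X i \<omega>) x \<partial>M)"
proof -
  interpret prob_space M using model by (simp add: shot_noise_model_def)
  have pp: "poisson_process M lam \<tau>"
    and ev: "(\<lambda>(f, t, s). f t s) \<in> borel_measurable (K \<Otimes>\<^sub>M borel \<Otimes>\<^sub>M borel)"
    and X: "\<And>i. 1 \<le> i \<Longrightarrow> X i \<in> borel_measurable M"
    and ind: "indep_elements M (Pi\<^sub>M {1..} (\<lambda>_. borel)) (random_sequence X)
       (Pi\<^sub>M {1..} (\<lambda>_. K) \<Otimes>\<^sub>M Pi\<^sub>M {1..} (\<lambda>_. borel))
       (\<lambda>\<omega>. (random_sequence h \<omega>, random_sequence \<tau> \<omega>))"
    using model unfolding shot_noise_model_def by blast+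
  define PX where "PX = (Pi\<^sub>M {1..} (\<lambda>_. borel) :: (nat \<Rightarrow> real) measure)"
  define Ph where "Ph = Pi\<^sub>M {1 :: nat..} (\<lambda>_. K)"
  define P\<tau> where "P\<tau> = (Pi\<^sub>M {1..} (\<lambda>_. borel) :: (nat \<Rightarrow> ereal) measure)"
  define Z where "Z \<omega> = (random_sequence h \<omega>, random_sequence \<tau> \<omega>)" for \<omega>
  have Xm: "random_sequence X \<in> measurable M PX" and Zm: "Z \<in> measurable M (Ph \<Otimes>\<^sub>M P\<tau>)"
    using ind by (simp_all add: indep_elements_def PX_def Ph_def P\<tau>_def Z_def[abs_def])
  define n where "n s = (LEAST n. ereal T < s (Suc n))" for s :: "nat \<Rightarrow> ereal"
  \<comment> \<open>The shot noise as a functional of shocks, shock functions and instants, with the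
    number of terms read off from the instants.\<close>
  define f where "f z = (\<Sum>i=1..n (snd (snd z)).
      fst (snd z) i T (real_of_ereal (snd (snd z) i)) * fst z i)"
    for z :: "(nat \<Rightarrow> real) \<times> (nat \<Rightarrow> real \<Rightarrow> real \<Rightarrow> real) \<times> (nat \<Rightarrow> ereal)"
  have f: "f \<in> borel_measurable (PX \<Otimes>\<^sub>M (Ph \<Otimes>\<^sub>M P\<tau>))"
    unfolding f_def
  proof (rule borel_measurable_sum_random_length[where
        f = "\<lambda>k z i. fst (snd z) i T (real_of_ereal (snd (snd z) i)) * fst z i"])
    have n: "n \<in> measurable P\<tau> (count_space UNIV)"
      unfolding n_def[abs_def] P\<tau>_def by (rule measurable_Least_sequence)
    show "(\<lambda>z. n (snd (snd z))) \<in> measurable (PX \<Otimes>\<^sub>M (Ph \<Otimes>\<^sub>M P\<tau>)) (count_space UNIV)"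
      by (rule measurable_compose[OF measurable_snd measurable_compose[OF measurable_snd n]])
    fix i :: nat assume i: "1 \<le> i"
    have cX: "(\<lambda>x. x i) \<in> borel_measurable PX"
      and ch: "(\<lambda>x. x i) \<in> measurable Ph K" and c\<tau>: "(\<lambda>x. x i) \<in> borel_measurable P\<tau>"
      using i unfolding PX_def Ph_def P\<tau>_def by (auto intro!: measurable_component_singleton)
    have X': "(\<lambda>z. fst z i) \<in> borel_measurable (PX \<Otimes>\<^sub>M (Ph \<Otimes>\<^sub>M P\<tau>))"
      by (rule measurable_compose[OF measurable_fst cX])
    have h': "(\<lambda>z. fst (snd z) i) \<in> measurable (PX \<Otimes>\<^sub>M (Ph \<Otimes>\<^sub>M P\<tau>)) K"
      by (rule measurable_compose[OF measurable_snd measurable_compose[OF measurable_fst ch]])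
    have \<tau>': "(\<lambda>z. real_of_ereal (snd (snd z) i)) \<in> borel_measurable (PX \<Otimes>\<^sub>M (Ph \<Otimes>\<^sub>M P\<tau>))"
      by (intro borel_measurable_real_of_ereal
          measurable_compose[OF measurable_snd measurable_compose[OF measurable_snd c\<tau>]])
    have "(\<lambda>z. (fst (snd z) i, T, real_of_ereal (snd (snd z) i))) \<in>
        measurable (PX \<Otimes>\<^sub>M (Ph \<Otimes>\<^sub>M P\<tau>)) (K \<Otimes>\<^sub>M borel \<Otimes>\<^sub>M borel)"
      by (intro measurable_Pair h' \<tau>') simp
    from measurable_compose[OF this ev]
    show "(\<lambda>z. fst (snd z) i T (real_of_ereal (snd (snd z) i)) * fst z i) \<in>
        borel_measurable (PX \<Otimes>\<^sub>M (Ph \<Otimes>\<^sub>M P\<tau>))"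
      by (intro borel_measurable_times X') simp
  qed
  have fsum: "f (random_sequence X \<omega>, Z \<omega>') = (\<Sum>i=1..counting \<tau> T \<omega>'.
      h i \<omega>' T (real_of_ereal (\<tau> i \<omega>')) * X i \<omega>)" if "\<omega>' \<in> space M" for \<omega> \<omega>'
    by (simp add: f_def Z_def n_def counting_eq_Least[OF pp that] random_sequence_nth)
  have Y: "shot_noise X h \<tau> T \<omega> = f (random_sequence X \<omega>, Z \<omega>)" if "\<omega> \<in> space M" for \<omega>
    by (simp add: fsum[OF that] shot_noise_def mult.commute)
  have "(\<lambda>\<omega>. f (random_sequence X \<omega>, Z \<omega>)) \<in> borel_measurable M"
    by (rule measurable_compose[OF measurable_Pair[OF Xm Zm] f])
  then show Ym: "shot_noise X h \<tau> T \<in> borel_measurable M"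
    by (rule measurable_cong[THEN iffD2, rotated]) (rule Y)
  define g :: "_ \<Rightarrow> ennreal" where "g z = indicator {x<..} (f z)" for z
  have g: "g \<in> borel_measurable (PX \<Otimes>\<^sub>M (Ph \<Otimes>\<^sub>M P\<tau>))"
    unfolding g_def[abs_def] by (rule measurable_compose[OF f]) simp
  let ?t = "\<lambda>\<omega>'. tail M (\<lambda>\<omega>. \<Sum>i=1..counting \<tau> T \<omega>'.
      h i \<omega>' T (real_of_ereal (\<tau> i \<omega>')) * X i \<omega>) x"
  have tail_eq: "ennreal (tail M Q x) = (\<integral>\<^sup>+\<omega>. indicator {x<..} (Q \<omega>) \<partial>M)"
    if [measurable]: "Q \<in> borel_measurable M" for Q
  proof -
    have "(\<integral>\<^sup>+\<omega>. indicator {x<..} (Q \<omega>) \<partial>M) = (\<integral>\<^sup>+\<omega>. indicator {\<omega>\<in>space M. Q \<omega> > x} \<omega> \<partial>M)"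
      by (intro nn_integral_cong) (auto split: split_indicator)
    then show ?thesis by (simp add: tail_def emeasure_eq_measure)
  qed
  have t: "ennreal (?t \<omega>') = (\<integral>\<^sup>+\<omega>. g (random_sequence X \<omega>, Z \<omega>') \<partial>M)" if "\<omega>' \<in> space M" for \<omega>'
    unfolding g_def fsum[OF that] using X by (intro tail_eq borel_measurable_sum borel_measurable_times) auto
  have "(\<lambda>(\<omega>', \<omega>). g (random_sequence X \<omega>, Z \<omega>')) \<in> borel_measurable (M \<Otimes>\<^sub>M M)"
    unfolding split_beta'
    by (rule measurable_compose[OF measurable_Pair[OF measurable_compose[OF measurable_snd Xm]
            measurable_compose[OF measurable_fst Zm]] g])
  then have "(\<lambda>\<omega>'. enn2real (\<integral>\<^sup>+\<omega>. g (random_sequence X \<omega>, Z \<omega>') \<partial>M)) \<in> borel_measurable M"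
    by (intro borel_measurable_enn2real borel_measurable_nn_integral)
  then show tm: "?t \<in> borel_measurable M"
    by (rule measurable_cong[THEN iffD2, rotated]) (simp flip: t add: tail_nonneg)
  have "ennreal (tail M (shot_noise X h \<tau> T) x) = (\<integral>\<^sup>+\<omega>. g (random_sequence X \<omega>, Z \<omega>) \<partial>M)"
    unfolding tail_eq[OF Ym] by (intro nn_integral_cong) (simp add: g_def Y)
  also have "\<dots> = (\<integral>\<^sup>+\<omega>'. \<integral>\<^sup>+\<omega>. g (random_sequence X \<omega>, Z \<omega>') \<partial>M \<partial>M)"
    by (rule indep_elements_nn_integral[OF prob_space_axioms ind[folded PX_def Ph_def P\<tau>_def Z_def] g])
  also have "\<dots> = (\<integral>\<^sup>+\<omega>'. ennreal (?t \<omega>') \<partial>M)"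
    by (rule nn_integral_cong) (rule t[symmetric])
  finally have "tail M (shot_noise X h \<tau> T) x = enn2real (\<integral>\<^sup>+\<omega>'. ennreal (?t \<omega>') \<partial>M)"
    by (metis enn2real_ennreal tail_nonneg)
  also have "\<dots> = (\<integral>\<omega>'. ?t \<omega>' \<partial>M)"
    using tm by (intro integral_eq_nn_integral[symmetric]) (auto simp: tail_nonneg)
  finally show "tail M (shot_noise X h \<tau> T) x = (\<integral>\<omega>'. ?t \<omega>' \<partial>M)" .
qed

theorem proposition16:
  fixes M :: "'w measure"
    and K :: "(real \<Rightarrow> real \<Rightarrow> real) measure"
    and L :: "(real \<Rightarrow> real) measure"
    and lam :: "real \<Rightarrow> real"
    and X :: "nat \<Rightarrow> 'w \<Rightarrow> real"
    and h :: "nat \<Rightarrow> 'w \<Rightarrow> real \<Rightarrow> real \<Rightarrow> real"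
    and \<tau> :: "nat \<Rightarrow> 'w \<Rightarrow> ereal"
    and h0 :: "'w \<Rightarrow> real \<Rightarrow> real \<Rightarrow> real"
    and V0 :: "'w \<Rightarrow> real"
    and T \<alpha> p \<gamma> :: real
  assumes model: "shot_noise_model M K lam X h \<tau>"
    and T: "0 < T" "0 < cumulative_intensity lam T"
    and h0: "h0 \<in> measurable M K" "distr M K h0 = distr M K (h 1)"
      "\<forall>\<omega>\<in>space M. \<forall>t\<ge>0. \<forall>s\<ge>0. 0 \<le> h0 \<omega> t s"
    and V0: "indep_elements M K h0 borel V0"
      "distributed M lborel V0
         (\<lambda>t. ennreal (lam t / cumulative_intensity lam T) * indicator {0..T} t)"
    and alpha: "0 < \<alpha>"
    and X: "\<forall>i\<ge>1. distr M borel (X i) = distr M borel (X 1)"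
      "integrable M (X 1)" "\<gamma> = integral\<^sup>L M (X 1)"
      "regularly_varying (tail M (X 1)) (- \<alpha>)"
    and asymptotic_independence:
      "((\<lambda>x. SUP (i, j)\<in>{(i, j). 1 \<le> i \<and> 1 \<le> j \<and> i \<noteq> j}.
           measure M {\<omega>\<in>space M. X i \<omega> > x \<and> X j \<omega> > x} / tail M (X 1) x) \<longlongrightarrow> 0) at_top"
    and slice: "(\<lambda>f. f T) \<in> measurable K L"
      "(\<lambda>(g, s). g s) \<in> borel_measurable (L \<Otimes>\<^sub>M borel)"
      "iid M L (\<lambda>i \<omega>. h i \<omega> T)"
      "indep_elements M
         (Pi\<^sub>M {1..} (\<lambda>_. L)) (random_sequence (\<lambda>i \<omega>. h i \<omega> T))
         (Pi\<^sub>M {1..} (\<lambda>_. borel)) (random_sequence \<tau>)"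
    and moment: "\<alpha> < p" "integrable M (\<lambda>\<omega>. (h0 \<omega> T (V0 \<omega>)) powr p)"
  shows "((\<lambda>x. expected_severity M (shot_noise X h \<tau> T) x / integrated_tail M (X 1) x)
           \<longlongrightarrow> \<gamma> * cumulative_intensity lam T * integral\<^sup>L M (\<lambda>\<omega>. (h0 \<omega> T (V0 \<omega>)) powr \<alpha>))
         at_top"
proof -
  interpret prob_space M using model by (simp add: shot_noise_model_def)
  have pm: "prob_space M" by (rule prob_space_axioms)
  let ?m = "cumulative_intensity lam T"
  define F where "F = tail M (X 1)"
  define N where "N = counting \<tau> T"
  define W where "W i \<omega> = h i \<omega> T (real_of_ereal (\<tau> i \<omega>))" for i \<omega>
  define Y where "Y = shot_noise X h \<tau> T"
  have pp: "poisson_process M lam \<tau>" and iid_h: "iid M K h"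
    and Xm: "\<And>i. 1 \<le> i \<Longrightarrow> X i \<in> borel_measurable M"
    and X0: "\<And>i \<omega>. 1 \<le> i \<Longrightarrow> \<omega> \<in> space M \<Longrightarrow> 0 \<le> X i \<omega>"
    and hpos: "\<And>i \<omega> s. 1 \<le> i \<Longrightarrow> \<omega> \<in> space M \<Longrightarrow> 0 \<le> s \<Longrightarrow> 0 \<le> h i \<omega> T s"
    using model \<open>0 < T\<close> unfolding shot_noise_model_def by (blast intro: less_imp_le)+
  have W0: "0 \<le> W i \<omega>" if "1 \<le> i" "\<omega> \<in> space M" for i \<omega>
  proof -
    \<comment> \<open>Absent points cause no trouble: \<open>real_of_ereal\<close> sends
      \<open>\<infinity>\<close> to 0, where the shock function is nonnegative too.\<close>
    have "0 \<le> \<tau> i \<omega>" using pp that unfolding poisson_process_def by blast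
    then show ?thesis unfolding W_def by (intro hpos that real_of_ereal_pos)
  qed
  have F: "tail M (X i) x = F x" if "1 \<le> i" for i x
  proof -
    have "tail M (X i) x = measure (distr M borel (X i)) {x<..}" if "1 \<le> i" for i
      using Xm[OF that] by (subst measure_distr) (auto simp: tail_def intro!: arg_cong[where f = prob])
    moreover have "distr M borel (X i) = distr M borel (X 1)" using X(1) that by blast
    ultimately show ?thesis using that by (simp add: F_def)
  qed
  have rv: "regularly_varying F (- \<alpha>)" using X(4) by (simp add: F_def)
  have F_anti: "F y \<le> F x" if "x \<le> y" for x y
    unfolding F_def using Xm[of 1] that by (intro tail_antimono[OF pm]) auto
  have F_le1: "F x \<le> 1" and F_nonneg: "0 \<le> F x" for x by (auto simp: F_def tail_def)
  \<comment> \<open>Regular variation gives positivity at high levels, and monotonicity carries it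
    down to all others.\<close>
  have F_pos: "0 < F x" for x
  proof -
    have "\<forall>\<^sub>F y in at_top. x \<le> y \<and> 0 < F y"
      using rv by (intro eventually_conj eventually_ge_at_top) (simp add: regularly_varying_def)
    then obtain y where "x \<le> y" "0 < F y" by (auto dest: eventually_happens)
    then show ?thesis using F_anti[of x y] by linarith
  qed
  have pairs: "((\<lambda>x. prob {\<omega>\<in>space M. X i \<omega> > x \<and> X j \<omega> > x} / F x) \<longlongrightarrow> 0) at_top"
    if ij: "1 \<le> i" "1 \<le> j" "i \<noteq> j" for i j
  proof (rule tendsto_sandwich[OF _ _ tendsto_const asymptotic_independence])
    let ?q = "\<lambda>x (i, j). prob {\<omega>\<in>space M. X i \<omega> > x \<and> X j \<omega> > x} / tail M (X 1) x"
    let ?S = "{(i, j). 1 \<le> i \<and> 1 \<le> j \<and> i \<noteq> (j :: nat)}"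
    \<comment> \<open>A real supremum bounds its members only when the set is bounded above; here
      every ratio is at most 1, the joint event lying inside that of one shock.\<close>
    have "?q x (i, j) \<le> 1" if "1 \<le> i" for x i j
    proof -
      have "prob {\<omega>\<in>space M. X i \<omega> > x \<and> X j \<omega> > x} \<le> tail M (X i) x"
        unfolding tail_def using Xm[OF that] by (intro finite_measure_mono) auto
      then show ?thesis using F[OF that] F_pos[of x] by (simp add: F_def)
    qed
    then have bdd: "bdd_above (?q x ` ?S)" for x by (intro bdd_aboveI[of _ 1]) auto
    have "?q x (i, j) \<le> (SUP z\<in>?S. ?q x z)" for x
      using ij by (intro cSUP_upper bdd) auto
    then show "\<forall>\<^sub>F x in at_top. prob {\<omega>\<in>space M. X i \<omega> > x \<and> X j \<omega> > x} / F x \<le>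
        (SUP z\<in>?S. ?q x z)"
      by (simp add: F_def)
  qed (auto simp: F_nonneg)

  \<comment> \<open>On \<open>{0..T}\<close> the intensity is \<open>?m\<close> times the density of
    \<open>V0\<close>, so the integral against the intensity is \<open>?m\<close> times a mean at
    the random instant \<open>V0\<close>. Nonnegative extended values leave finiteness to be decided
    separately for each \<open>\<phi>\<close>.\<close>
  have mean: "(\<integral>\<^sup>+\<omega>. (\<Sum>i=1..N \<omega>. ennreal (c ^ N \<omega>) * \<phi> (W i \<omega>)) \<partial>M) =
      ennreal (c * exp (?m * (c - 1)) * ?m) * (\<integral>\<^sup>+\<omega>. \<phi> (h0 \<omega> T (V0 \<omega>)) \<partial>M)"
    if c: "0 \<le> c" and \<phi>: "\<phi> \<in> borel_measurable borel" for c :: real and \<phi> :: "real \<Rightarrow> ennreal"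
  proof -
    define G where "G s = (\<integral>\<^sup>+\<omega>. \<phi> (h0 \<omega> T s) \<partial>M)" for s
    have slice_m: "(\<lambda>f. \<phi> (f T s)) \<in> borel_measurable K" for s
      by (rule measurable_eval_compose[OF slice(2,1) measurable_const \<phi>]) simp
    have h1: "h 1 \<in> measurable M K"
      using iid_h by (auto simp: iid_def indep_vars_def)
    have h0T: "(\<lambda>\<omega>. h0 \<omega> T) \<in> measurable M L"
      by (rule measurable_compose[OF h0(1) slice(1)])
    have G_h: "(\<integral>\<^sup>+\<omega>. \<phi> (h 1 \<omega> T s) \<partial>M) = G s" for s
    proof -
      have "(\<integral>\<^sup>+\<omega>. \<phi> (h 1 \<omega> T s) \<partial>M) = (\<integral>\<^sup>+f. \<phi> (f T s) \<partial>distr M K (h 1))"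
        by (rule nn_integral_distr[OF h1, symmetric]) (simp add: slice_m)
      also have "\<dots> = (\<integral>\<^sup>+f. \<phi> (f T s) \<partial>distr M K h0)" by (simp only: h0(2))
      also have "\<dots> = G s"
        unfolding G_def by (rule nn_integral_distr[OF h0(1)]) (simp add: slice_m)
      finally show ?thesis .
    qed
    have "(\<lambda>(s, \<omega>). \<phi> (h0 \<omega> T s)) \<in> borel_measurable (borel \<Otimes>\<^sub>M M)"
      unfolding split_beta'
      by (rule measurable_eval_compose[OF slice(2) measurable_compose[OF measurable_snd h0T] measurable_fst \<phi>])
    then have G: "G \<in> borel_measurable borel"
      unfolding G_def[abs_def] by (intro borel_measurable_nn_integral)
    have "(\<lambda>(f, s). \<phi> (f T s)) \<in> borel_measurable (K \<Otimes>\<^sub>M borel)"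
      unfolding split_beta'
      by (rule measurable_eval_compose[OF slice(2) measurable_compose[OF measurable_fst slice(1)] measurable_snd \<phi>])
    from indep_elements_nn_integral[OF pm V0(1) this]
    have "(\<integral>\<^sup>+\<omega>. \<phi> (h0 \<omega> T (V0 \<omega>)) \<partial>M) = (\<integral>\<^sup>+\<omega>. G (V0 \<omega>) \<partial>M)"
      by (simp add: G_def)
    also have "\<dots> = (\<integral>\<^sup>+s. (ennreal (lam s / ?m) * indicator {0..T} s) * G s \<partial>lborel)"
      using G by (intro distributed_nn_integral[OF V0(2), symmetric]) simp
    finally have V: "ennreal ?m * (\<integral>\<^sup>+\<omega>. \<phi> (h0 \<omega> T (V0 \<omega>)) \<partial>M) =
        ennreal ?m * (\<integral>\<^sup>+s. (ennreal (lam s / ?m) * indicator {0..T} s) * G s \<partial>lborel)" by simp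
    also have "\<dots> = (\<integral>\<^sup>+s. ennreal ?m * ((ennreal (lam s / ?m) * indicator {0..T} s) * G s) \<partial>lborel)"
      using G distributed_borel_measurable[OF V0(2)] by (intro nn_integral_cmult[symmetric]) simp
    also have "\<dots> = (\<integral>\<^sup>+s. ennreal (indicator {0..T} s * lam s) * G s \<partial>lborel)"
    proof (rule nn_integral_cong)
      fix s
      show "ennreal ?m * ((ennreal (lam s / ?m) * indicator {0..T} s) * G s) =
          ennreal (indicator {0..T} s * lam s) * G s"
      proof (cases "s \<in> {0..T}")
        case True
        then have "0 \<le> lam s" using poisson_process_intensity(1)[OF pp] by simp
        then have "ennreal ?m * ennreal (lam s / ?m) = ennreal (lam s)"
          using T(2) by (simp flip: ennreal_mult)
        then show ?thesis using True by (simp flip: mult.assoc)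
      qed simp
    qed
    finally have V: "(\<integral>\<^sup>+s. ennreal (indicator {0..T} s * lam s) * G s \<partial>lborel) =
        ennreal ?m * (\<integral>\<^sup>+\<omega>. \<phi> (h0 \<omega> T (V0 \<omega>)) \<partial>M)" by simp
    have "0 \<le> T" using T by simp
    from marked_poisson_process_campbell[OF pm pp this c slice(2,3,4) \<phi>]
    have "(\<integral>\<^sup>+\<omega>. (\<Sum>i=1..N \<omega>. ennreal (c ^ N \<omega>) * \<phi> (W i \<omega>)) \<partial>M) =
        ennreal (c * exp (?m * (c - 1))) * (ennreal ?m * (\<integral>\<^sup>+\<omega>. \<phi> (h0 \<omega> T (V0 \<omega>)) \<partial>M))"
      unfolding N_def W_def G_h V .
    also have "\<dots> = ennreal (c * exp (?m * (c - 1)) * ?m) * (\<integral>\<^sup>+\<omega>. \<phi> (h0 \<omega> T (V0 \<omega>)) \<partial>M)"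
      using c T(2) by (simp add: ennreal_mult mult.assoc)
    finally show ?thesis .
  qed

  \<comment> \<open>\<open>Q x\<close> is the tail of the shot noise given the marks,
    \<open>S\<close> the limit of \<open>Q x / F x\<close>, and \<open>B\<close> the dominating
    function up to a constant.\<close>
  define Q where "Q x \<omega> = tail M (\<lambda>\<omega>'. \<Sum>i=1..N \<omega>. W i \<omega> * X i \<omega>') x" for x \<omega>
  define S where "S \<omega> = (\<Sum>i=1..N \<omega>. W i \<omega> powr \<alpha>)" for \<omega>
  define B where "B \<omega> = (\<Sum>i=1..N \<omega>. exp p ^ N \<omega> * (1 + W i \<omega> powr p))" for \<omega>
  have Nm: "N \<in> measurable M (count_space UNIV)"
    unfolding N_def by (rule measurable_counting[OF pp])
  have Wm: "W i \<in> borel_measurable M" if i: "1 \<le> i" for i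
  proof -
    have "h i \<in> measurable M K" using iid_h i by (auto simp: iid_def indep_vars_def)
    then have hT: "(\<lambda>\<omega>. h i \<omega> T) \<in> measurable M L" by (rule measurable_compose[OF _ slice(1)])
    have "\<tau> i \<in> borel_measurable M" using pp i unfolding poisson_process_def by blast
    then have \<tau>: "(\<lambda>\<omega>. real_of_ereal (\<tau> i \<omega>)) \<in> borel_measurable M"
      by (rule borel_measurable_real_of_ereal)
    show ?thesis unfolding W_def[abs_def]
      by (rule measurable_eval_compose[OF slice(2) hT \<tau>, where \<phi> = "\<lambda>w. w"]) simp
  qed
  have Sm: "S \<in> borel_measurable M" unfolding S_def[abs_def]
  proof (rule borel_measurable_sum_random_length[where f = "\<lambda>k \<omega> i. W i \<omega> powr \<alpha>", OF Nm])
    fix i :: nat assume "1 \<le> i"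
    note [measurable] = Wm[OF this]
    show "(\<lambda>\<omega>. W i \<omega> powr \<alpha>) \<in> borel_measurable M" by measurable
  qed
  have Bm: "B \<in> borel_measurable M" unfolding B_def[abs_def]
  proof (rule borel_measurable_sum_random_length[where
        f = "\<lambda>k \<omega> i. exp p ^ k * (1 + W i \<omega> powr p)", OF Nm])
    fix k i :: nat assume "1 \<le> i"
    note [measurable] = Wm[OF this]
    show "(\<lambda>\<omega>. exp p ^ k * (1 + W i \<omega> powr p)) \<in> borel_measurable M" by measurable
  qed
  have Qm: "Q x \<in> borel_measurable M" and tail_Y: "tail M Y x = (\<integral>\<omega>. Q x \<omega> \<partial>M)" for x
    using measurable_decoupled_tail[OF model, of T x] tail_shot_noise[OF model, of T x]
    by (simp_all add: Q_def[abs_def] W_def N_def Y_def)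
  have Ym: "Y \<in> borel_measurable M" unfolding Y_def by (rule measurable_shot_noise[OF model])
  have "0 < p" using alpha moment(1) by simp

  \<comment> \<open>The constant from Campbell's formula at \<open>c = exp p\<close> is finite
    whatever \<open>p\<close> is, so integrability rests on the moment of order
    \<open>p\<close>.\<close>
  have B_int: "integrable M B"
  proof (rule integrableI_bounded[OF Bm])
    have "(\<integral>\<^sup>+\<omega>. ennreal (norm (B \<omega>)) \<partial>M) =
        (\<integral>\<^sup>+\<omega>. (\<Sum>i=1..N \<omega>. ennreal (exp p ^ N \<omega>) * ennreal (1 + W i \<omega> powr p)) \<partial>M)"
    proof (rule nn_integral_cong)
      fix \<omega>
      have "0 \<le> B \<omega>" unfolding B_def by (intro sum_nonneg mult_nonneg_nonneg) auto
      then have "ennreal (norm (B \<omega>)) = (\<Sum>i=1..N \<omega>. ennreal (exp p ^ N \<omega> * (1 + W i \<omega> powr p)))"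
        by (simp add: B_def sum_ennreal)
      also have "\<dots> = (\<Sum>i=1..N \<omega>. ennreal (exp p ^ N \<omega>) * ennreal (1 + W i \<omega> powr p))"
        by (intro sum.cong refl ennreal_mult) auto
      finally show "ennreal (norm (B \<omega>)) =
          (\<Sum>i=1..N \<omega>. ennreal (exp p ^ N \<omega>) * ennreal (1 + W i \<omega> powr p))" .
    qed
    also have "\<dots> = ennreal (exp p * exp (?m * (exp p - 1)) * ?m) *
        (\<integral>\<^sup>+\<omega>. ennreal (1 + h0 \<omega> T (V0 \<omega>) powr p) \<partial>M)"
      by (rule mean[of "exp p" "\<lambda>w. ennreal (1 + w powr p)"]) auto
    also have "(\<integral>\<^sup>+\<omega>. ennreal (1 + h0 \<omega> T (V0 \<omega>) powr p) \<partial>M) =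
        ennreal (\<integral>\<omega>. 1 + h0 \<omega> T (V0 \<omega>) powr p \<partial>M)"
      using moment(2) by (intro nn_integral_eq_integral) auto
    also have "ennreal (exp p * exp (?m * (exp p - 1)) * ?m) * \<dots> < \<infinity>"
      by (simp add: ennreal_mult_less_top)
    finally show "(\<integral>\<^sup>+\<omega>. ennreal (norm (B \<omega>)) \<partial>M) < \<infinity>" .
  qed

  \<comment> \<open>For \<open>c = 1\<close> the exponential factor disappears. Passing through
    \<open>enn2real\<close> on both sides gives the equality before the moment of order
    \<open>\<alpha>\<close> is known to be finite.\<close>
  have S_int: "(\<integral>\<omega>. S \<omega> \<partial>M) = ?m * (\<integral>\<omega>. h0 \<omega> T (V0 \<omega>) powr \<alpha> \<partial>M)"
  proof -
    have meas: "(\<lambda>\<omega>. h0 \<omega> T (V0 \<omega>) powr \<alpha>) \<in> borel_measurable M"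
      by (rule measurable_eval_compose[OF slice(2) measurable_compose[OF h0(1) slice(1)], where \<phi> = "\<lambda>w. w powr \<alpha>"])
        (use V0(1) in \<open>auto simp: indep_elements_def\<close>)
    have "0 \<le> S \<omega>" for \<omega> by (auto simp: S_def intro!: sum_nonneg)
    then have "(\<integral>\<omega>. S \<omega> \<partial>M) = enn2real (\<integral>\<^sup>+\<omega>. ennreal (S \<omega>) \<partial>M)"
      using Sm by (intro integral_eq_nn_integral) auto
    also have "(\<integral>\<^sup>+\<omega>. ennreal (S \<omega>) \<partial>M) =
        (\<integral>\<^sup>+\<omega>. (\<Sum>i=1..N \<omega>. ennreal (1 ^ N \<omega>) * ennreal (W i \<omega> powr \<alpha>)) \<partial>M)"
      by (intro nn_integral_cong) (simp add: S_def sum_ennreal)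
    also have "\<dots> = ennreal (1 * exp (?m * (1 - 1)) * ?m) * (\<integral>\<^sup>+\<omega>. ennreal (h0 \<omega> T (V0 \<omega>) powr \<alpha>) \<partial>M)"
      by (rule mean[of 1 "\<lambda>w. ennreal (w powr \<alpha>)"]) auto
    also have "enn2real \<dots> = ?m * enn2real (\<integral>\<^sup>+\<omega>. ennreal (h0 \<omega> T (V0 \<omega>) powr \<alpha>) \<partial>M)"
      using T(2) by (simp add: enn2real_mult)
    also have "enn2real (\<integral>\<^sup>+\<omega>. ennreal (h0 \<omega> T (V0 \<omega>) powr \<alpha>) \<partial>M) = (\<integral>\<omega>. h0 \<omega> T (V0 \<omega>) powr \<alpha> \<partial>M)"
      using meas by (intro integral_eq_nn_integral[symmetric]) auto
    finally show ?thesis .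
  qed

  obtain C x0 where C: "0 \<le> C" "0 < x0"
    and CF: "\<And>x w. x0 \<le> x \<Longrightarrow> 0 < w \<Longrightarrow> F (x / w) \<le> C * (1 + w powr p) * F x"
    using regularly_varying_scaling_bound[OF rv F_anti F_le1 alpha moment(1)] by metis
  have "((\<lambda>x. \<integral>\<omega>. Q x \<omega> / F x \<partial>M) \<longlongrightarrow> (\<integral>\<omega>. S \<omega> \<partial>M)) at_top"
  proof (rule integral_dominated_convergence_at_top)
    show "integrable M (\<lambda>\<omega>. C * B \<omega>)" using B_int by simp
    show "\<forall>\<^sub>F x in at_top. AE \<omega> in M. norm (Q x \<omega> / F x) \<le> C * B \<omega>"
      using eventually_ge_at_top[of x0]
    proof eventually_elim
      \<comment> \<open>The threshold \<open>x0\<close> depends on \<open>F\<close> and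
        \<open>p\<close>, but neither on the weights nor on their number, so one \<open>x0\<close>
        serves all \<open>\<omega>\<close>.\<close>
      case (elim x)
      have "norm (Q x \<omega> / F x) \<le> C * B \<omega>" if \<omega>: "\<omega> \<in> space M" for \<omega>
      proof -
        have "Q x \<omega> \<le> C * B \<omega> * F x" unfolding Q_def B_def
          using C elim \<open>0 < p\<close> \<omega> by (intro tail_weighted_sum_bound[OF pm] Xm F W0 CF F_nonneg) auto
        then show ?thesis using F_pos[of x] tail_nonneg[of M _ x] by (simp add: Q_def field_simps)
      qed
      then show ?case by (intro AE_I2)
    qed
    show "AE \<omega> in M. ((\<lambda>x. Q x \<omega> / F x) \<longlongrightarrow> S \<omega>) at_top"
    proof (rule AE_I2)
      fix \<omega> assume "\<omega> \<in> space M"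
      then show "((\<lambda>x. Q x \<omega> / F x) \<longlongrightarrow> S \<omega>) at_top"
        unfolding Q_def S_def
        by (intro tail_weighted_sum_limit[OF pm _ _ _ _ rv] Xm X0 W0 F pairs) auto
    qed
  qed (use Sm Qm in auto)
  then have "((\<lambda>x. tail M Y x / F x) \<longlongrightarrow> ?m * (\<integral>\<omega>. h0 \<omega> T (V0 \<omega>) powr \<alpha> \<partial>M)) at_top"
    by (simp add: S_int tail_Y)
  from expected_severity_asymptotics[OF pm Ym X(2) F_pos[unfolded F_def] this[unfolded F_def]]
  have "((\<lambda>x. \<gamma> * (expected_severity M Y x / (LBINT u:{x..}. tail M (X 1) u))) \<longlongrightarrow>
      \<gamma> * (?m * (\<integral>\<omega>. h0 \<omega> T (V0 \<omega>) powr \<alpha> \<partial>M))) at_top"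
    by (rule tendsto_mult_left)
  \<comment> \<open>The mean \<open>\<gamma>\<close> in the final constant undoes the normalisation
    \<open>1 / \<gamma>\<close> of the integrated tail.\<close>
  moreover have "expected_severity M Y x / integrated_tail M (X 1) x =
      \<gamma> * (expected_severity M Y x / (LBINT u:{x..}. tail M (X 1) u))" for x
    by (simp add: integrated_tail_def X(3))
  ultimately show ?thesis by (simp only: Y_def mult.assoc)
qed

end
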